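(* Let $M_H=\{(z,w)\in\mathbb C^n\times\mathbb C:\operatorname{Im}w=P_C(z,\bar z)\}$ be a holomorphically nondegenerate model admitting a nontrivial $Y\in\mathfrak g_c$. Then $P_C$ can be decomposed as $$P_C=\sum_{j=1}^M T_j,\qquad T_j=\operatorname{Re}\Big(\sum_{k=1}^{N_j}\big\langle U_j^{(k)},V_j^{(N_j-k+1)}\big\rangle\Big),$$ where, for each $j$, $\{U_j^{(1)},\dots,U_j^{(N_j)}\}$ and $\{V_j^{(1)},\dots,V_j^{(N_j)}\}$ form a symmetric pair of $Y_{s_j}$-chains (for some positive integers $M$, $N_j$, $s_j$), and $\langle\cdot,\cdot\rangle$ is the usual scalar product in $\mathbb C^{s_j}$. Conversely, if $Y=\sum_{j=1}^nF_j(z)\partial_{z_j}$ is a weighted homogeneous holomorphic vector field of strictly positive weight and $P_C$ has a decomposition $$P_C=\sum_{j=1}^M \operatorname{Re}\Big(\sum_{k=1}^{N_j}\big\langle U_j^{(k)},V_j^{(N_j-k+1)}\big\rangle\Big)$$ for some positive integers $M$, $N_j$, $s_j$, where, for each $j$, $\{U_j^{(1)},\dots,U_j^{(N_j)}\}$ and $\{V_j^{(1)},\dots,V_j^{(N_j)}\}$ form a symmetric pair of $Y_{s_j}$-chains, then $Y\in\mathfrak g_c$.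
   Context: Multitype and models. A weight is an $n$-tuple of rationals $\Lambda=(\lambda_1,\dots,\lambda_n)$ with $0\le\lambda_j\le\frac12$ and $\lambda_j\ge\lambda_{j+1}$. The variables $w,\operatorname{Re}w,\operatorname{Im}w$ have weight $1$ and $z_j,\bar z_j$ have weight $\lambda_j$; a polynomial is weighted homogeneous of degree $\kappa$ if all its monomials $c\,z^\alpha\bar z^\beta(\operatorname{Re}w)^l$ satisfy $l+\sum_i(\alpha_i+\beta_i)\lambda_i=\kappa$. For a smooth real hypersurface $M\subset\mathbb C^{n+1}$ and a point $p\in M$ of finite type in the sense of Kohn and Bloom–Graham, $\Lambda$ is distinguished if there are local holomorphic coordinates $(z,w)$ vanishing at $p$ in which $M$ is $\operatorname{Im}w=P(z,\bar z)+o_\Lambda(1)$, where $P\ne0$ is weighted homogeneous of degree $1$ without pluriharmonic terms and $o_\Lambda(1)$ is a smooth function whose derivatives of weighted order $\le1$ vanish at the origin. The multitype weight $(\mu_1,\dots,\mu_n)$ is the lexicographic infimum of all distinguished weights; $M$ has finite (Catlin) multitype at $p$ if all $\mu_j\neq0$. Coordinates in which $M$ has this form with $\Lambda=(\mu_1,\dots,\mu_n)$ are multitype coordinates; then $P$ is denoted $P_C$, and $M_H=\{\operatorname{Im}w=P_C(z,\bar z)\}$ is the model of $M$ at $p$. Here $M_H$ is such a model of finite Catlin multitype, so $P_C$ is weighted homogeneous of degree $1$ with respect to the multitype weights $\mu_j>0$. $M_H$ is holomorphically nondegenerate if there is no nonzero germ at $0$ of a holomorphic vector field tangent to $M_H$.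 $\mathrm{aut}(M_H,0)$ is the Lie algebra of germs at $0$ of holomorphic vector fields in $\mathbb C^{n+1}$ whose real part is tangent to $M_H$. A field $\sum_jF_j\partial_{z_j}+G\partial_w$ has weight $\mu$ if each $F_j$ is weighted homogeneous of degree $\mu+\mu_j$ and $G$ of degree $\mu+1$. $\mathfrak g_c$ is the component of $\mathrm{aut}(M_H,0)$ consisting of (weighted homogeneous) rigid fields, i.e. fields whose coefficients do not depend on $w$ (equivalently commuting with $\partial_w$), of weight strictly bigger than $0$ (by known results the weight then lies in $(0,1)$). Chains. Let $Y$ be a weighted homogeneous holomorphic vector field. A pair of finite sequences $\{U^{(1)},\dots,U^{(l)}\}$, $\{V^{(1)},\dots,V^{(l)}\}$ of $\mathbb C^s$-valued holomorphic weighted homogeneous polynomials in $z$ is a symmetric pair of $Y_s$-chains if $$Y(U^{(l)})=0,\quad Y(U^{(j)})=A_jU^{(j+1)},\qquad Y(V^{(l)})=0,\quad Y(V^{(j)})=B_jV^{(j+1)},\qquad j=1,\dots,l-1,$$ where $A_j,B_j$ are invertible $s\times s$ complex matrices with $A_j=-{}^t\overline{B_{l-j}}$ ($Y$ acts componentwise). The scalar product is linear in the first and conjugate-linear in the second argument. *)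

theory Defs
  imports
    "HOL-Analysis.Analysis"
    "HOL-Library.Fun_Lexorder"
    "HOL-Library.Landau_Symbols"
    "Jordan_Normal_Form.Matrix"
begin

(* From here on "$" is the component of a vector in complex^'n, while complex vec and complex mat
   are the Jordan_Normal_Form types, used for the spaces C^s of variable dimension. *)
no_notation Matrix.vec_index (infixl "$" 100)

section \<open>Smooth and holomorphic functions of several variables\<close>

definition iter_deriv :: "'a::euclidean_space list \<Rightarrow> ('a \<Rightarrow> real) \<Rightarrow> 'a \<Rightarrow> real" where
  "iter_deriv bs f = foldr (\<lambda>b g x. frechet_derivative g (at x) b) bs f"

text \<open>Smoothness on an open set: all iterated partial derivatives exist and are differentiable
  (hence continuous).\<close>

definition smooth_on :: "'a::euclidean_space set \<Rightarrow> ('a \<Rightarrow> real) \<Rightarrow> bool" where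
  "smooth_on S f \<longleftrightarrow> (\<forall>bs. set bs \<subseteq> Basis \<longrightarrow> iter_deriv bs f differentiable_on S)"

text \<open>The space \<open>C^(n+1)\<close> with coordinates \<open>(z, w)\<close> is the type \<open>(complex^'n) \<times> complex\<close>, which carries
  no complex scalar multiplication in the library.\<close>

definition cscale :: "complex \<Rightarrow> (complex^'n) \<times> complex \<Rightarrow> (complex^'n) \<times> complex" where
  "cscale c x = (c *s fst x, c * snd x)"

definition hol_on :: "((complex^'n) \<times> complex) set \<Rightarrow> ((complex^'n) \<times> complex \<Rightarrow> complex) \<Rightarrow> bool" where
  "hol_on S f \<longleftrightarrow>
     (\<forall>x\<in>S. \<exists>D. (f has_derivative D) (at x) \<and> (\<forall>c v. D (cscale c v) = c * D v))"

definition hol_map_on ::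
    "((complex^'n) \<times> complex) set \<Rightarrow> ((complex^'n) \<times> complex \<Rightarrow> (complex^'n) \<times> complex) \<Rightarrow> bool" where
  "hol_map_on S F \<longleftrightarrow> (\<forall>j. hol_on S (\<lambda>x. fst (F x) $ j)) \<and> hol_on S (\<lambda>x. snd (F x))"

text \<open>Wirtinger derivatives \<open>\<partial>/\<partial>z\<^sub>j\<close> and \<open>\<partial>/\<partial>w\<close>.\<close>

definition wirtinger_z ::
    "'n \<Rightarrow> ((complex^'n) \<times> complex \<Rightarrow> complex) \<Rightarrow> (complex^'n) \<times> complex \<Rightarrow> complex" where
  "wirtinger_z j f x =
     (frechet_derivative f (at x) (axis j 1, 0)
       - \<i> * frechet_derivative f (at x) (axis j \<i>, 0)) / 2"

definition wirtinger_w ::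
    "((complex^'n) \<times> complex \<Rightarrow> complex) \<Rightarrow> (complex^'n) \<times> complex \<Rightarrow> complex" where
  "wirtinger_w f x =
     (frechet_derivative f (at x) (0, 1) - \<i> * frechet_derivative f (at x) (0, \<i>)) / 2"

section \<open>Weights and weighted homogeneous polynomials\<close>

definition is_weight :: "('n::{finite,linorder} \<Rightarrow> rat) \<Rightarrow> bool" where
  "is_weight \<Lambda> \<longleftrightarrow> (\<forall>j. 0 \<le> \<Lambda> j \<and> \<Lambda> j \<le> 1 / 2) \<and> antimono \<Lambda>"

definition wdeg :: "('n::finite \<Rightarrow> rat) \<Rightarrow> ('n \<Rightarrow> nat) \<Rightarrow> rat" where
  "wdeg \<Lambda> \<alpha> = (\<Sum>i\<in>UNIV. of_nat (\<alpha> i) * \<Lambda> i)"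

definition zmonom :: "complex^'n \<Rightarrow> ('n \<Rightarrow> nat) \<Rightarrow> complex" where
  "zmonom z \<alpha> = (\<Prod>i\<in>UNIV. (z $ i) ^ \<alpha> i)"

text \<open>\<open>f\<close> is a polynomial in \<open>z\<close> and its conjugate, all of whose monomials
  \<open>z^\<alpha> * cnj z^\<beta>\<close> have exponents \<open>(\<alpha>, \<beta>)\<close> in \<open>E\<close>.\<close>

definition zzbar_poly :: "(('n \<Rightarrow> nat) \<times> ('n \<Rightarrow> nat)) set \<Rightarrow> (complex^'n \<Rightarrow> complex) \<Rightarrow> bool" where
  "zzbar_poly E f \<longleftrightarrow>
     (\<exists>S c. finite S \<and> S \<subseteq> E \<and>
        f = (\<lambda>z. \<Sum>(\<alpha>, \<beta>)\<in>S. c \<alpha> \<beta> * zmonom z \<alpha> * cnj (zmonom z \<beta>)))"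

definition whom_zzbar :: "('n::finite \<Rightarrow> rat) \<Rightarrow> rat \<Rightarrow> (complex^'n \<Rightarrow> complex) \<Rightarrow> bool" where
  "whom_zzbar \<Lambda> \<kappa> f \<longleftrightarrow> zzbar_poly {(\<alpha>, \<beta>). wdeg \<Lambda> \<alpha> + wdeg \<Lambda> \<beta> = \<kappa>} f"

definition no_pluriharmonic_terms :: "(complex^'n \<Rightarrow> complex) \<Rightarrow> bool" where
  "no_pluriharmonic_terms f \<longleftrightarrow> zzbar_poly {(\<alpha>, \<beta>). \<alpha> \<noteq> (\<lambda>_. 0) \<and> \<beta> \<noteq> (\<lambda>_. 0)} f"

definition whom_z :: "('n::finite \<Rightarrow> rat) \<Rightarrow> rat \<Rightarrow> (complex^'n \<Rightarrow> complex) \<Rightarrow> bool" where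
  "whom_z \<Lambda> \<kappa> f \<longleftrightarrow>
     (\<exists>S c. finite S \<and> (\<forall>\<alpha>\<in>S. wdeg \<Lambda> \<alpha> = \<kappa>) \<and> f = (\<lambda>z. \<Sum>\<alpha>\<in>S. c \<alpha> * zmonom z \<alpha>))"

definition whom_zw :: "('n::finite \<Rightarrow> rat) \<Rightarrow> rat \<Rightarrow> ((complex^'n) \<times> complex \<Rightarrow> complex) \<Rightarrow> bool" where
  "whom_zw \<Lambda> \<kappa> f \<longleftrightarrow>
     (\<exists>S c. finite S \<and> (\<forall>(\<alpha>, l)\<in>S. wdeg \<Lambda> \<alpha> + of_nat l = \<kappa>) \<and>
        f = (\<lambda>(z, w). \<Sum>(\<alpha>, l)\<in>S. c \<alpha> l * zmonom z \<alpha> * w ^ l))"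

section \<open>Hypersurfaces, finite type, multitype and models\<close>

definition local_defining_function ::
    "((complex^'n) \<times> complex) set \<Rightarrow> (complex^'n) \<times> complex \<Rightarrow>
     ((complex^'n) \<times> complex) set \<Rightarrow> ((complex^'n) \<times> complex \<Rightarrow> real) \<Rightarrow> bool" where
  "local_defining_function M p U r \<longleftrightarrow>
     open U \<and> p \<in> U \<and> smooth_on U r \<and> (\<forall>x\<in>U. frechet_derivative r (at x) \<noteq> (\<lambda>_. 0)) \<and>
     M \<inter> U = {x \<in> U. r x = 0}"

definition smooth_real_hypersurface :: "((complex^'n) \<times> complex) set \<Rightarrow> bool" where
  "smooth_real_hypersurface M \<longleftrightarrow> (\<forall>p\<in>M. \<exists>U r. local_defining_function M p U r)"

definition complex_hypersurface_through ::
    "(complex^'n) \<times> complex \<Rightarrow> ((complex^'n) \<times> complex) set \<Rightarrow> bool" where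
  "complex_hypersurface_through p X \<longleftrightarrow>
     (\<exists>S h. open S \<and> p \<in> S \<and> hol_on S h \<and> h p = 0 \<and>
        (\<forall>x\<in>S. frechet_derivative h (at x) \<noteq> (\<lambda>_. 0)) \<and> X = {x \<in> S. h x = 0})"

text \<open>Bloom--Graham finite type: the order of contact of \<open>M\<close> with the smooth complex hypersurfaces
  through \<open>p\<close> is bounded.\<close>

definition finite_type :: "((complex^'n) \<times> complex) set \<Rightarrow> (complex^'n) \<times> complex \<Rightarrow> bool" where
  "finite_type M p \<longleftrightarrow>
     (\<exists>U r. local_defining_function M p U r \<and>
        (\<exists>m::nat. \<forall>X. complex_hypersurface_through p X \<longrightarrow>
           r \<notin> o[at p within X](\<lambda>x. norm (x - p) ^ m)))"

text \<open>Holomorphic coordinates defined on the neighbourhood \<open>S\<close> of \<open>p\<close> and vanishing at \<open>p\<close>.\<close>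

definition hol_coordinates ::
    "(complex^'n) \<times> complex \<Rightarrow> ((complex^'n) \<times> complex) set \<Rightarrow>
     ((complex^'n) \<times> complex \<Rightarrow> (complex^'n) \<times> complex) \<Rightarrow> bool" where
  "hol_coordinates p S \<phi> \<longleftrightarrow>
     open S \<and> p \<in> S \<and> \<phi> p = 0 \<and> inj_on \<phi> S \<and> open (\<phi> ` S) \<and>
     hol_map_on S \<phi> \<and> hol_map_on (\<phi> ` S) (inv_into S \<phi>)"

text \<open>Weighted order of a partial derivative in \<open>C^n \<times> R\<close> (coordinates \<open>(z, Re w)\<close>). The basis
  vectors are the directions \<open>Re z\<^sub>j\<close>, \<open>Im z\<^sub>j\<close>, \<open>Re w\<close>; since \<open>\<partial>/\<partial>z\<^sub>j\<close>, \<open>\<partial>/\<partial>cnj z\<^sub>j\<close> and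
  \<open>\<partial>/\<partial>Re z\<^sub>j\<close>, \<open>\<partial>/\<partial>Im z\<^sub>j\<close> span the same operators, all of weight \<open>\<Lambda>\<^sub>j\<close>, the condition
  below does not depend on which of them are used.\<close>

definition dir_weight :: "('n::finite \<Rightarrow> rat) \<Rightarrow> (complex^'n) \<times> real \<Rightarrow> rat" where
  "dir_weight \<Lambda> b =
     (\<Sum>j\<in>UNIV. if fst b $ j \<noteq> 0 then \<Lambda> j else 0) + (if snd b \<noteq> 0 then 1 else 0)"

definition weighted_little_o ::
    "('n::finite \<Rightarrow> rat) \<Rightarrow> ((complex^'n) \<times> real) set \<Rightarrow> ((complex^'n) \<times> real \<Rightarrow> real) \<Rightarrow> bool" where
  "weighted_little_o \<Lambda> N R \<longleftrightarrow>
     open N \<and> 0 \<in> N \<and> smooth_on N R \<and>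
     (\<forall>bs. set bs \<subseteq> Basis \<longrightarrow> sum_list (map (dir_weight \<Lambda>) bs) \<le> 1 \<longrightarrow> iter_deriv bs R 0 = 0)"

text \<open>Near \<open>p\<close> and in suitable local holomorphic coordinates,
  \<open>M\<close> is \<open>Im w = P(z, cnj z) + o\<^sub>\<Lambda>(1)\<close>.\<close>

definition has_leading_polynomial ::
    "((complex^'n) \<times> complex) set \<Rightarrow> (complex^'n) \<times> complex \<Rightarrow> ('n::finite \<Rightarrow> rat) \<Rightarrow>
     (complex^'n \<Rightarrow> real) \<Rightarrow> bool" where
  "has_leading_polynomial M p \<Lambda> P \<longleftrightarrow>
     P \<noteq> (\<lambda>_. 0) \<and> whom_zzbar \<Lambda> 1 (\<lambda>z. complex_of_real (P z)) \<and>
     no_pluriharmonic_terms (\<lambda>z. complex_of_real (P z)) \<and>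
     (\<exists>S \<phi> N R. hol_coordinates p S \<phi> \<and> weighted_little_o \<Lambda> N R \<and>
        (\<forall>x\<in>S. (fst (\<phi> x), Re (snd (\<phi> x))) \<in> N \<and>
           (x \<in> M \<longleftrightarrow> Im (snd (\<phi> x)) = P (fst (\<phi> x)) + R (fst (\<phi> x), Re (snd (\<phi> x))))))"

definition distinguished_weight ::
    "((complex^'n::{finite,linorder}) \<times> complex) set \<Rightarrow> (complex^'n::{finite,linorder}) \<times> complex \<Rightarrow>
     ('n::{finite,linorder} \<Rightarrow> rat) \<Rightarrow> bool" where
  "distinguished_weight M p \<Lambda> \<longleftrightarrow> is_weight \<Lambda> \<and> (\<exists>P. has_leading_polynomial M p \<Lambda> P)"

text \<open>The greatest lower bound in the lexicographic order, for which \<^const>\<open>less_fun\<close> is the strict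
  part.\<close>

definition multitype_weight ::
    "((complex^'n::{finite,linorder}) \<times> complex) set \<Rightarrow> (complex^'n::{finite,linorder}) \<times> complex \<Rightarrow>
     ('n::{finite,linorder} \<Rightarrow> rat) \<Rightarrow> bool" where
  "multitype_weight M p \<mu> \<longleftrightarrow>
     is_weight \<mu> \<and> (\<forall>\<Lambda>. distinguished_weight M p \<Lambda> \<longrightarrow> \<not> less_fun \<Lambda> \<mu>) \<and>
     (\<forall>\<nu>. is_weight \<nu> \<and> (\<forall>\<Lambda>. distinguished_weight M p \<Lambda> \<longrightarrow> \<not> less_fun \<Lambda> \<nu>) \<longrightarrow> \<not> less_fun \<mu> \<nu>)"

text \<open>\<open>Im w = P(z, cnj z)\<close> is the model, at a point of finite type and finite Catlin multitype, of
  some smooth real hypersurface with multitype weight \<open>\<mu>\<close>.\<close>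

definition is_model ::
    "('n::{finite,linorder} \<Rightarrow> rat) \<Rightarrow> (complex^'n::{finite,linorder} \<Rightarrow> real) \<Rightarrow> bool" where
  "is_model \<mu> P \<longleftrightarrow>
     (\<exists>M p. smooth_real_hypersurface M \<and> p \<in> M \<and> finite_type M p \<and>
        multitype_weight M p \<mu> \<and> (\<forall>j. \<mu> j \<noteq> 0) \<and> has_leading_polynomial M p \<mu> P)"

definition model_hypersurface :: "(complex^'n \<Rightarrow> real) \<Rightarrow> ((complex^'n) \<times> complex) set" where
  "model_hypersurface P = {(z, w). Im w = P z}"

definition model_defining :: "(complex^'n \<Rightarrow> real) \<Rightarrow> (complex^'n) \<times> complex \<Rightarrow> complex" where
  "model_defining P = (\<lambda>(z, w). complex_of_real (Im w - P z))"

section \<open>Holomorphic vector fields\<close>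

text \<open>The field \<open>\<Sum>\<^sub>j F\<^sub>j \<partial>/\<partial>z\<^sub>j + G \<partial>/\<partial>w\<close> is the map \<open>x \<mapsto> (F x, G x)\<close>; a germ at \<open>0\<close> is
  represented by any such map, of which only the behaviour near \<open>0\<close> matters.\<close>

type_synonym 'n vfield = "(complex^'n) \<times> complex \<Rightarrow> (complex^'n) \<times> complex"

definition nonzero_germ :: "('n::finite) vfield \<Rightarrow> bool" where
  "nonzero_germ Y \<longleftrightarrow> \<not> (\<forall>\<^sub>F x in nhds 0. Y x = 0)"

definition apply_field ::
    "('n::finite) vfield \<Rightarrow> ((complex^'n) \<times> complex \<Rightarrow> complex) \<Rightarrow> (complex^'n) \<times> complex \<Rightarrow> complex" where
  "apply_field Y f x =
     (\<Sum>j\<in>UNIV. fst (Y x) $ j * wirtinger_z j f x) + snd (Y x) * wirtinger_w f x"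

definition hol_nondegenerate :: "(complex^'n \<Rightarrow> real) \<Rightarrow> bool" where
  "hol_nondegenerate P \<longleftrightarrow>
     \<not> (\<exists>Y S. open S \<and> 0 \<in> S \<and> hol_map_on S Y \<and> nonzero_germ Y \<and>
          (\<forall>x \<in> S \<inter> model_hypersurface P. apply_field Y (model_defining P) x = 0))"

text \<open>As \<open>model_defining P\<close> is real valued, \<open>Re Y\<close> applied to it is the real part of \<open>Y\<close> applied to
  it.\<close>

definition aut_fields :: "(complex^'n \<Rightarrow> real) \<Rightarrow> ('n::finite) vfield set" where
  "aut_fields P =
     {Y. \<exists>S. open S \<and> 0 \<in> S \<and> hol_map_on S Y \<and>
        (\<forall>x \<in> S \<inter> model_hypersurface P. Re (apply_field Y (model_defining P) x) = 0)}"

definition whom_field :: "('n::finite \<Rightarrow> rat) \<Rightarrow> rat \<Rightarrow> 'n vfield \<Rightarrow> bool" where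
  "whom_field \<mu> \<nu> Y \<longleftrightarrow>
     (\<forall>j. whom_zw \<mu> (\<nu> + \<mu> j) (\<lambda>x. fst (Y x) $ j)) \<and> whom_zw \<mu> (\<nu> + 1) (\<lambda>x. snd (Y x))"

definition rigid_field :: "('n::finite) vfield \<Rightarrow> bool" where
  "rigid_field Y \<longleftrightarrow> (\<forall>z w w'. Y (z, w) = Y (z, w'))"

definition g_c :: "('n::finite \<Rightarrow> rat) \<Rightarrow> (complex^'n \<Rightarrow> real) \<Rightarrow> 'n vfield set" where
  "g_c \<mu> P = {Y \<in> aut_fields P. rigid_field Y \<and> (\<exists>\<nu>>0. whom_field \<mu> \<nu> Y)}"

section \<open>Chains\<close>

text \<open>A \<open>C^s\<close>-valued weighted homogeneous polynomial: all components have the same weighted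
  degree.\<close>

definition whom_vec :: "('n::finite \<Rightarrow> rat) \<Rightarrow> nat \<Rightarrow> (complex^'n \<Rightarrow> complex vec) \<Rightarrow> bool" where
  "whom_vec \<mu> s U \<longleftrightarrow>
     (\<forall>z. U z \<in> carrier_vec s) \<and> (\<exists>\<kappa>. \<forall>i<s. whom_z \<mu> \<kappa> (\<lambda>z. vec_index (U z) i))"

text \<open>\<open>Y\<close> acting componentwise on a function of \<open>z\<close> alone. The result is a function of \<open>(z, w)\<close>,
  as the coefficients of \<open>Y\<close> may involve \<open>w\<close>.\<close>

definition apply_field_vec ::
    "('n::finite) vfield \<Rightarrow> nat \<Rightarrow> (complex^'n \<Rightarrow> complex vec) \<Rightarrow> (complex^'n) \<times> complex \<Rightarrow> complex vec"
  where
  "apply_field_vec Y s U x = vec s (\<lambda>i. apply_field Y (\<lambda>y. vec_index (U (fst y)) i) x)"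

definition symmetric_chain_pair ::
    "('n::finite \<Rightarrow> rat) \<Rightarrow> 'n vfield \<Rightarrow> nat \<Rightarrow> nat \<Rightarrow>
     (nat \<Rightarrow> complex^'n \<Rightarrow> complex vec) \<Rightarrow> (nat \<Rightarrow> complex^'n \<Rightarrow> complex vec) \<Rightarrow> bool" where
  "symmetric_chain_pair \<mu> Y s l U V \<longleftrightarrow>
     (\<forall>k\<in>{1..l}. whom_vec \<mu> s (U k) \<and> whom_vec \<mu> s (V k)) \<and>
     (\<forall>z w. apply_field_vec Y s (U l) (z, w) = 0\<^sub>v s \<and> apply_field_vec Y s (V l) (z, w) = 0\<^sub>v s) \<and>
     (\<exists>A B. \<forall>j\<in>{1..<l}.
        A j \<in> carrier_mat s s \<and> invertible_mat (A j) \<and>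
        B j \<in> carrier_mat s s \<and> invertible_mat (B j) \<and>
        A j = - transpose_mat (map_mat cnj (B (l - j))) \<and>
        (\<forall>z w. apply_field_vec Y s (U j) (z, w) = A j *\<^sub>v U (j + 1) z \<and>
               apply_field_vec Y s (V j) (z, w) = B j *\<^sub>v V (j + 1) z))"

text \<open>\<open>P\<close> is the sum of \<open>M\<close> terms, the \<open>j\<close>-th one coming from a symmetric pair of chains of length
  \<open>N j\<close> in dimension \<open>s j\<close>. The product \<open>\<bullet>c\<close> is linear in the first and conjugate-linear in the
  second argument.\<close>

definition has_chain_decomposition ::
    "('n::finite \<Rightarrow> rat) \<Rightarrow> 'n vfield \<Rightarrow> (complex^'n \<Rightarrow> real) \<Rightarrow> bool" where
  "has_chain_decomposition \<mu> Y P \<longleftrightarrow>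
     (\<exists>(M::nat) (N::nat \<Rightarrow> nat) (s::nat \<Rightarrow> nat) U V. 0 < M \<and>
        (\<forall>j\<in>{1..M}. 0 < N j \<and> 0 < s j \<and> symmetric_chain_pair \<mu> Y (s j) (N j) (U j) (V j)) \<and>
        (\<forall>z. P z = (\<Sum>j=1..M. Re (\<Sum>k=1..N j. U j k z \<bullet>c V j (N j - k + 1) z))))"

end

(*
  For a rigid field Y = F d/dz + G d/dw let X be the derivation F d/dz. Write P(z, z) as the diagonal
  of a polarized sum T(z, zeta) = sum_i a_i(z) cnj (b_i(zeta)) with a_i, b_i weighted homogeneous.
  Tangency of Re Y forces G = 0 and (X + cnj X) T = 0, and such T are spanned by the tensors
    sum_{k<N} X^k u (x) cnj ((-X)^(N-1-k) v),   X^N u = X^N v = 0,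
  each of which is a symmetric pair of chains with s = 1, A_j = 1, B_j = -1. For the spanning
  statement one inducts on the number of summands of T. If the a_i and the b_i are both independent,
  invariance gives X a = C a and X b = - C^* b with a matrix C, nilpotent since X raises weights. With
  N minimal such that C^N = 0 and c = (C^(N-1))_pq nonzero, subtracting the tensor of u = a_p,
  v = b_q / cnj c turns the a_i into functions a'_i with sum_i (C^(N-1))_pi a'_i = 0, so that one
  summand can be dropped.
*)
theory Submission
  imports Defs
begin

section \<open>Invariant tensors\<close>

text \<open>The operator X does not by itself act on a family \<open>a i\<close>. For independent
  b_i, invariance moves X to the other factor, and functionals dual to the b_i then exhibit X a_i as
  a combination of the a_j; the adjoint on the b side comes from independence of the a_j. Hence
  dependent families are reduced before a chain is split off. Why the subtraction works: X^k b_q is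
  a combination of the b_i, so the tensor of u and v can be written over the same b_i, with
  coefficient (C^(N-1-k))_iq / c in front of X^k a_p. Summed over i against the row p of C^(N-1),
  all terms but k = N-1 die because C^N = 0, and the last one is X^(N-1) a_p, the very combination
  to be cancelled; this fixes the constant c. The a_i and b_i keep complementary weights throughout,
  since chains must be homogeneous and nilpotency rests on weights. The tensors split off need not
  be Hermitian: P is real, so real parts are taken term by term at the end. G disappears because it
  enters through G(z) - cnj (G(zeta)), and at zeta = 0 all the rest vanishes.\<close>

definition tens :: "'i set \<Rightarrow> ('i \<Rightarrow> 'p \<Rightarrow> complex) \<Rightarrow> ('i \<Rightarrow> 'p \<Rightarrow> complex) \<Rightarrow> 'p \<Rightarrow> 'p \<Rightarrow> complex" where
  "tens I a b z \<zeta> = (\<Sum>i\<in>I. a i z * cnj (b i \<zeta>))"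

definition lin_indep :: "'i set \<Rightarrow> ('i \<Rightarrow> 'p \<Rightarrow> complex) \<Rightarrow> bool" where
  "lin_indep I a \<longleftrightarrow> (\<forall>c. (\<forall>z. (\<Sum>i\<in>I. c i * a i z) = 0) \<longrightarrow> (\<forall>i\<in>I. c i = 0))"

lemma lin_indepD:
  "lin_indep I a \<Longrightarrow> (\<And>z. (\<Sum>i\<in>I. c i * a i z) = 0) \<Longrightarrow> i \<in> I \<Longrightarrow> c i = 0"
  unfolding lin_indep_def by blast

lemma lin_indep_eqD:
  assumes "lin_indep I a" "\<And>z. (\<Sum>i\<in>I. c i * a i z) = (\<Sum>i\<in>I. d i * a i z)" "i \<in> I"
  shows "c i = d i"
  using lin_indepD[OF assms(1), of "\<lambda>i. c i - d i"] assms(2,3)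
  by (simp add: left_diff_distrib sum_subtractf)

section \<open>Functionals dual to an independent family\<close>

definition eval_comb :: "(('p \<Rightarrow> complex) \<Rightarrow> complex) \<Rightarrow> bool" where
  "eval_comb L \<longleftrightarrow> (\<exists>S w. finite S \<and> L = (\<lambda>f. \<Sum>s\<in>S. w s * f s))"

lemma eval_comb_point: "eval_comb (\<lambda>f. f p)"
  unfolding eval_comb_def by (rule exI[of _ "{p}"], rule exI[of _ "\<lambda>_. 1"]) simp

lemma eval_comb_zero: "eval_comb (\<lambda>f. 0)"
  unfolding eval_comb_def by (rule exI[of _ "{}"]) simp

lemma eval_comb_scale:
  assumes "eval_comb L" shows "eval_comb (\<lambda>f. c * L f)"
proof -
  obtain S w where "finite S" "L = (\<lambda>f. \<Sum>s\<in>S. w s * f s)"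
    using assms unfolding eval_comb_def by blast
  then show ?thesis
    unfolding eval_comb_def
    by (intro exI[of _ S] exI[of _ "\<lambda>s. c * w s"]) (simp add: sum_distrib_left mult.assoc)
qed

lemma eval_comb_add:
  assumes "eval_comb L" "eval_comb L'" shows "eval_comb (\<lambda>f. L f + L' f)"
proof -
  obtain S w where S: "finite S" "L = (\<lambda>f. \<Sum>s\<in>S. w s * f s)"
    using assms(1) unfolding eval_comb_def by blast
  obtain S' w' where S': "finite S'" "L' = (\<lambda>f. \<Sum>s\<in>S'. w' s * f s)"
    using assms(2) unfolding eval_comb_def by blast
  have "L f + L' f =
      (\<Sum>s\<in>S \<union> S'. ((if s \<in> S then w s else 0) + (if s \<in> S' then w' s else 0)) * f s)" for f
  proof -
    have "L f = (\<Sum>s\<in>S \<union> S'. (if s \<in> S then w s else 0) * f s)"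
      unfolding S(2) by (rule sum.mono_neutral_cong_left) (use S S' in auto)
    moreover have "L' f = (\<Sum>s\<in>S \<union> S'. (if s \<in> S' then w' s else 0) * f s)"
      unfolding S'(2) by (rule sum.mono_neutral_cong_left) (use S S' in auto)
    ultimately show ?thesis by (simp add: distrib_right sum.distrib)
  qed
  then show ?thesis
    unfolding eval_comb_def using S S'
    by (intro exI[of _ "S \<union> S'"]
        exI[of _ "\<lambda>s. (if s \<in> S then w s else 0) + (if s \<in> S' then w' s else 0)"]) auto
qed

lemma eval_comb_sum:
  "finite I \<Longrightarrow> (\<And>i. i \<in> I \<Longrightarrow> eval_comb (L i)) \<Longrightarrow> eval_comb (\<lambda>f. \<Sum>i\<in>I. L i f)"
  by (induction I rule: finite_induct) (simp_all add: eval_comb_zero eval_comb_add)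

lemma eval_comb_lin:
  assumes "eval_comb L"
  shows "L (\<lambda>s. \<Sum>i\<in>I. c i * f i s) = (\<Sum>i\<in>I. c i * L (f i))"
proof -
  obtain S w where S: "finite S" "L = (\<lambda>f. \<Sum>s\<in>S. w s * f s)"
    using assms unfolding eval_comb_def by blast
  show ?thesis
    unfolding S(2) sum_distrib_left by (subst sum.swap) (simp add: mult_ac)
qed

text \<open>By induction, as in Gaussian elimination. Combinations of point evaluations suffice:
  once its components along the earlier \<open>b i\<close> are removed, \<open>b m\<close> is still
  not the zero function, so some point \<open>p\<close> detects it. Such functionals apply to any
  function, in particular to \<open>X (b j)\<close> later.\<close>

lemma dual_functionals:
  assumes "finite I" "lin_indep I b"
  shows "\<exists>L. \<forall>i\<in>I. eval_comb (L i) \<and> (\<forall>k\<in>I. L i (b k) = (if k = i then 1 else 0))"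
  using assms
proof (induction I rule: finite_induct)
  case empty
  then show ?case by simp
next
  case (insert m I)
  have "lin_indep I b"
    unfolding lin_indep_def
  proof (intro allI impI ballI)
    fix c i assume c: "\<forall>z. (\<Sum>i\<in>I. c i * b i z) = 0" and i: "i \<in> I"
    have "(\<Sum>i\<in>insert m I. (c(m := 0)) i * b i z) = 0" for z
    proof -
      have "(\<Sum>i\<in>I. (c(m := 0)) i * b i z) = (\<Sum>i\<in>I. c i * b i z)"
        by (rule sum.cong) (use insert.hyps in auto)
      then show ?thesis using insert.hyps c by simp
    qed
    from lin_indepD[OF insert.prems this, of i] i insert.hyps show "c i = 0"
      by (auto split: if_splits)
  qed
  then obtain L where L: "\<And>i. i \<in> I \<Longrightarrow> eval_comb (L i)"
    "\<And>i k. i \<in> I \<Longrightarrow> k \<in> I \<Longrightarrow> L i (b k) = (if k = i then 1 else 0)"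
    using insert.IH by blast
  define g where "g z = b m z - (\<Sum>i\<in>I. L i (b m) * b i z)" for z
  have "\<exists>p. g p \<noteq> 0"
  proof (rule ccontr)
    assume "\<not> ?thesis"
    then have "(\<Sum>i\<in>insert m I. (if i = m then 1 else - L i (b m)) * b i z) = 0" for z
    proof -
      have "(\<Sum>i\<in>I. (if i = m then 1 else - L i (b m)) * b i z) = (\<Sum>i\<in>I. - L i (b m) * b i z)"
        by (rule sum.cong) (use insert.hyps in auto)
      then show ?thesis
        using insert.hyps \<open>\<not> (\<exists>p. g p \<noteq> 0)\<close> unfolding g_def by (simp add: sum_negf)
    qed
    from lin_indepD[OF insert.prems this, of m] show False by simp
  qed
  then obtain p where p: "g p \<noteq> 0" by blast
  \<comment> \<open>The value at \<open>p\<close> of what remains of \<open>f\<close> after removing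
    its components along the family, normalised by the same remainder \<open>g\<close> of
    \<open>b m\<close>; hence it vanishes on the earlier \<open>b k\<close>.\<close>
  define Lm where "Lm f = (1 / g p) * (f p + (\<Sum>i\<in>I. (- b i p) * L i f))" for f
  have Lm: "eval_comb Lm"
    unfolding Lm_def[abs_def]
    by (intro eval_comb_scale eval_comb_add eval_comb_point eval_comb_sum insert.hyps L) auto
  have Lm_m: "Lm (b m) = 1"
    using p unfolding Lm_def g_def by (simp add: sum_negf mult.commute)
  have Lm_k: "Lm (b k) = 0" if "k \<in> I" for k
  proof -
    have "(\<Sum>i\<in>I. (- b i p) * L i (b k)) = (\<Sum>i\<in>I. if i = k then - b k p else 0)"
      by (rule sum.cong) (use that L in auto)
    then show ?thesis using that insert.hyps unfolding Lm_def by simp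
  qed
  \<comment> \<open>A multiple of \<open>Lm\<close> repairs the value at \<open>b m\<close> without
    touching the values on the old family.\<close>
  define L' where "L' i = (if i = m then Lm else (\<lambda>f. L i f + (- L i (b m)) * Lm f))" for i
  have "eval_comb (L' i)" if "i \<in> insert m I" for i
    using that L(1)[of i] Lm eval_comb_add[OF L(1) eval_comb_scale[OF Lm, of "- L i (b m)"], of i]
    unfolding L'_def by auto
  moreover have "L' i (b k) = (if k = i then 1 else 0)" if "i \<in> insert m I" "k \<in> insert m I" for i k
    using that L Lm_m Lm_k insert.hyps unfolding L'_def by auto
  ultimately show ?case by blast
qed

text \<open>\<open>H \<kappa>\<close> stands for the homogeneous functions of weight
  \<open>\<kappa>\<close>, \<open>X\<close> for the derivation F d/dz, and \<open>W\<close> for a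
  space on which \<open>X\<close> is linear. \<open>W\<close> is kept apart from \<open>H\<close>
  because slices of a tensor mix weights. \<open>H_separate\<close> says that the sum over different
  weights is direct.\<close>

locale graded_operator =
  fixes H :: "rat \<Rightarrow> ('p \<Rightarrow> complex) \<Rightarrow> bool"
    and W :: "('p \<Rightarrow> complex) \<Rightarrow> bool"
    and X :: "('p \<Rightarrow> complex) \<Rightarrow> 'p \<Rightarrow> complex"
    and \<nu> :: rat
  assumes \<nu>_pos: "0 < \<nu>"
    and H_zero: "H \<kappa> (\<lambda>_. 0)"
    and H_add: "H \<kappa> f \<Longrightarrow> H \<kappa> g \<Longrightarrow> H \<kappa> (\<lambda>z. f z + g z)"
    and H_scale: "H \<kappa> f \<Longrightarrow> H \<kappa> (\<lambda>z. c * f z)"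
    and H_separate: "finite K \<Longrightarrow> (\<And>k. k \<in> K \<Longrightarrow> H k (h k)) \<Longrightarrow> (\<And>z. (\<Sum>k\<in>K. h k z) = 0)
      \<Longrightarrow> k \<in> K \<Longrightarrow> h k z = 0"
    and H_X: "H \<kappa> f \<Longrightarrow> H (\<kappa> + \<nu>) (X f)"
    and H_W: "H \<kappa> f \<Longrightarrow> W f"
    and W_add: "W f \<Longrightarrow> W g \<Longrightarrow> W (\<lambda>z. f z + g z)"
    and W_scale: "W f \<Longrightarrow> W (\<lambda>z. c * f z)"
    and X_add: "W f \<Longrightarrow> W g \<Longrightarrow> X (\<lambda>z. f z + g z) = (\<lambda>z. X f z + X g z)"
    and X_scale: "W f \<Longrightarrow> X (\<lambda>z. c * f z) = (\<lambda>z. c * X f z)"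
begin

lemma W_zero: "W (\<lambda>_. 0)"
  using H_zero H_W by blast

lemma X_zero: "X (\<lambda>_. 0) = (\<lambda>_. 0)"
  using X_scale[OF W_zero, of 0] by simp

lemma H_sum:
  assumes "finite I" "\<And>i. i \<in> I \<Longrightarrow> c i \<noteq> 0 \<Longrightarrow> H \<kappa> (f i)"
  shows "H \<kappa> (\<lambda>z. \<Sum>i\<in>I. c i * f i z)"
  using assms
proof (induction I rule: finite_induct)
  case empty
  then show ?case by (simp add: H_zero)
next
  case (insert i I)
  have "H \<kappa> (\<lambda>z. c i * f i z)"
    using insert.prems[of i] H_scale H_zero by (cases "c i = 0") auto
  then show ?case using insert by (simp add: H_add)
qed

lemma W_sum:
  assumes "finite I" "\<And>i. i \<in> I \<Longrightarrow> W (f i)"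
  shows "W (\<lambda>z. \<Sum>i\<in>I. c i * f i z)"
  using assms by (induction I rule: finite_induct) (simp_all add: W_zero W_add W_scale)

lemma X_sum:
  assumes "finite I" "\<And>i. i \<in> I \<Longrightarrow> W (f i)"
  shows "X (\<lambda>z. \<Sum>i\<in>I. c i * f i z) = (\<lambda>z. \<Sum>i\<in>I. c i * X (f i) z)"
  using assms
  by (induction I rule: finite_induct)
    (simp_all add: X_zero X_add X_scale W_scale W_sum)

lemma H_funpow: "H \<kappa> f \<Longrightarrow> H (\<kappa> + of_nat k * \<nu>) ((X ^^ k) f)"
proof (induction k)
  case (Suc k)
  from H_X[OF Suc.IH[OF Suc.prems]] show ?case by (simp add: algebra_simps)
qed simp

lemma X_funpow_sum:
  assumes "finite I" "\<And>i. i \<in> I \<Longrightarrow> H (\<kappa> i) (f i)"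
  shows "(X ^^ k) (\<lambda>z. \<Sum>i\<in>I. c i * f i z) = (\<lambda>z. \<Sum>i\<in>I. c i * (X ^^ k) (f i) z)"
proof (induction k)
  case (Suc k)
  then show ?case
    using X_sum[OF assms(1), of "\<lambda>i. (X ^^ k) (f i)"] H_W[OF H_funpow[OF assms(2)]] by simp
qed simp

lemma X_funpow_zero: "(X ^^ k) (\<lambda>_. 0) = (\<lambda>_. 0)"
  by (induction k) (simp_all add: X_zero)

lemma X_funpow_scale:
  assumes "H \<kappa> f" shows "(X ^^ k) (\<lambda>z. c * f z) = (\<lambda>z. c * (X ^^ k) f z)"
  using X_funpow_sum[of "{0::nat}" "\<lambda>_. \<kappa>" "\<lambda>_. f" k "\<lambda>_. c"] assms by simp

lemma separate_sum:
  assumes "finite I" "\<And>i. i \<in> I \<Longrightarrow> H (\<kappa> i) (f i)" "\<And>z. (\<Sum>i\<in>I. c i * f i z) = 0"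
  shows "(\<Sum>i | i \<in> I \<and> \<kappa> i = k. c i * f i z) = 0"
proof (cases "k \<in> \<kappa> ` I")
  case True
  have "H k' (\<lambda>z. \<Sum>i | i \<in> I \<and> \<kappa> i = k'. c i * f i z)" for k'
    by (rule H_sum) (use assms in auto)
  moreover have "(\<Sum>k'\<in>\<kappa> ` I. \<Sum>i | i \<in> I \<and> \<kappa> i = k'. c i * f i z) = 0" for z
    using assms(3) by (subst sum.group) (use assms(1) in auto)
  ultimately show ?thesis
    using H_separate[of "\<kappa> ` I" "\<lambda>k' z. \<Sum>i | i \<in> I \<and> \<kappa> i = k'. c i * f i z"] True assms(1)
    by blast
next
  case False
  then have "{i. i \<in> I \<and> \<kappa> i = k} = {}" by auto
  then show ?thesis by (simp only: sum.empty)
qed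

text \<open>Appending \<open>g\<close> (index \<open>None\<close>) to the family with coefficient -1
  gives a relation. If the weights differed, its part of weight \<open>\<kappa> i\<close> would not
  contain \<open>g\<close> and would contradict independence.\<close>

lemma combination_weight:
  assumes I: "finite I" "\<And>i. i \<in> I \<Longrightarrow> H (\<kappa> i) (f i)" "lin_indep I f"
    and g: "H k g" "\<And>z. g z = (\<Sum>i\<in>I. c i * f i z)" and i: "i \<in> I" "c i \<noteq> 0"
  shows "\<kappa> i = k"
proof (rule ccontr)
  assume ne: "\<kappa> i \<noteq> k"
  define J where "J = insert None (Some ` I)"
  define f' where "f' = case_option g f"
  define c' where "c' = case_option (-1) c"
  define \<kappa>' where "\<kappa>' = case_option k \<kappa>"
  have *: "(\<Sum>j | j \<in> J \<and> \<kappa>' j = \<kappa> i. c' j * f' j z) = 0" for z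
  proof (rule separate_sum)
    show "finite J" unfolding J_def using I(1) by simp
    show "H (\<kappa>' j) (f' j)" if "j \<in> J" for j
      using that I(2) g(1) unfolding J_def f'_def \<kappa>'_def by auto
    show "(\<Sum>j\<in>J. c' j * f' j z) = 0" for z
      unfolding J_def f'_def c'_def using I(1) g(2) by (simp add: sum.reindex)
  qed
  have "(\<Sum>j\<in>I. (if \<kappa> j = \<kappa> i then c j else 0) * f j z) = 0" for z
  proof -
    have "{j. j \<in> J \<and> \<kappa>' j = \<kappa> i} = Some ` {j \<in> I. \<kappa> j = \<kappa> i}"
      using ne unfolding J_def \<kappa>'_def by auto
    then have "(\<Sum>j | j \<in> I \<and> \<kappa> j = \<kappa> i. c j * f j z) = 0"
      using *[of z] unfolding c'_def f'_def by (simp add: sum.reindex)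
    moreover have "(\<Sum>j\<in>I. (if \<kappa> j = \<kappa> i then c j else 0) * f j z)
        = (\<Sum>j | j \<in> I \<and> \<kappa> j = \<kappa> i. c j * f j z)"
      by (rule sum.mono_neutral_cong_right) (use I(1) in auto)
    ultimately show ?thesis by simp
  qed
  from lin_indepD[OF I(3) this i(1)] i(2) show False by simp
qed

text \<open>This is (X + cnj X) T = 0: \<open>T\<close> depends on \<open>\<zeta>\<close> through
  conjugates, so the second operator conjugates, applies \<open>X\<close> and conjugates
  back.\<close>

definition invariant_tensor :: "('p \<Rightarrow> 'p \<Rightarrow> complex) \<Rightarrow> bool" where
  "invariant_tensor T \<longleftrightarrow>
     (\<forall>z \<zeta>. X (\<lambda>z. T z \<zeta>) z + cnj (X (\<lambda>\<zeta>. cnj (T z \<zeta>)) \<zeta>) = 0)"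

lemma X_tens_left:
  assumes "finite I" "\<And>i. i \<in> I \<Longrightarrow> W (a i)"
  shows "X (\<lambda>z. tens I a b z \<zeta>) z = tens I (\<lambda>i. X (a i)) b z \<zeta>"
  using fun_cong[OF X_sum[of I a "\<lambda>i. cnj (b i \<zeta>)"], of z] assms
  unfolding tens_def by (simp add: mult.commute)

lemma X_tens_right:
  assumes "finite I" "\<And>i. i \<in> I \<Longrightarrow> W (b i)"
  shows "cnj (X (\<lambda>\<zeta>. cnj (tens I a b z \<zeta>)) \<zeta>) = tens I a (\<lambda>i. X (b i)) z \<zeta>"
  using fun_cong[OF X_sum[of I b "\<lambda>i. cnj (a i z)"], of \<zeta>] assms
  unfolding tens_def by simp

lemma W_tens:
  assumes "finite I"
  shows "(\<And>i. i \<in> I \<Longrightarrow> W (a i)) \<Longrightarrow> W (\<lambda>z. tens I a b z \<zeta>)"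
    and "(\<And>i. i \<in> I \<Longrightarrow> W (b i)) \<Longrightarrow> W (\<lambda>\<zeta>. cnj (tens I a b z \<zeta>))"
  using W_sum[of I a "\<lambda>i. cnj (b i \<zeta>)"] W_sum[of I b "\<lambda>i. cnj (a i z)"] assms
  unfolding tens_def by (simp_all add: mult.commute)

lemma invariant_tens_iff:
  assumes "finite I" "\<And>i. i \<in> I \<Longrightarrow> W (a i)" "\<And>i. i \<in> I \<Longrightarrow> W (b i)"
  shows "invariant_tensor (tens I a b) \<longleftrightarrow>
    (\<forall>z \<zeta>. tens I (\<lambda>i. X (a i)) b z \<zeta> + tens I a (\<lambda>i. X (b i)) z \<zeta> = 0)"
  unfolding invariant_tensor_def using assms by (simp add: X_tens_left X_tens_right)

section \<open>Chain tensors and their invariance\<close>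

definition chain_tensor :: "nat \<Rightarrow> ('p \<Rightarrow> complex) \<Rightarrow> ('p \<Rightarrow> complex) \<Rightarrow> 'p \<Rightarrow> 'p \<Rightarrow> complex" where
  "chain_tensor N u v =
     tens {..<N} (\<lambda>k. (X ^^ k) u) (\<lambda>k \<zeta>. (-1) ^ (N - 1 - k) * (X ^^ (N - 1 - k)) v \<zeta>)"

definition chain_data :: "nat \<times> ('p \<Rightarrow> complex) \<times> ('p \<Rightarrow> complex) \<Rightarrow> bool" where
  "chain_data = (\<lambda>(N, u, v). 0 < N \<and> (\<exists>k. H k u) \<and> (\<exists>k. H k v) \<and>
     (X ^^ N) u = (\<lambda>_. 0) \<and> (X ^^ N) v = (\<lambda>_. 0))"

text \<open>The two derivatives of summand i are \<open>?g (Suc i)\<close> and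
  \<open>- ?g i\<close>, so the total telescopes to \<open>?g N - ?g 0\<close>. The first contains
  X^N u and the second X^N v.\<close>

lemma invariant_chain_tensor:
  assumes "chain_data (N, u, v)"
  shows "invariant_tensor (chain_tensor N u v)"
proof -
  obtain k l where H: "H k u" "H l v" and N: "0 < N"
    and Xu: "(X ^^ N) u = (\<lambda>_. 0)" and Xv: "(X ^^ N) v = (\<lambda>_. 0)"
    using assms unfolding chain_data_def by auto
  have Wv: "W ((X ^^ i) v)" for i using H_W[OF H_funpow[OF H(2)]] .
  obtain m where m: "N = Suc m" using N gr0_conv_Suc by blast
  let ?g = "\<lambda>i z \<zeta>. (X ^^ i) u z * cnj ((-1) ^ (N - i) * (X ^^ (N - i)) v \<zeta>)"
  have "tens {..<N} (\<lambda>i. X ((X ^^ i) u))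
        (\<lambda>i \<zeta>. (-1) ^ (N - 1 - i) * (X ^^ (N - 1 - i)) v \<zeta>) z \<zeta>
      + tens {..<N} (\<lambda>i. (X ^^ i) u)
        (\<lambda>i. X (\<lambda>\<zeta>. (-1) ^ (N - 1 - i) * (X ^^ (N - 1 - i)) v \<zeta>)) z \<zeta> = 0" for z \<zeta>
  proof -
    have "tens {..<N} (\<lambda>i. X ((X ^^ i) u))
        (\<lambda>i \<zeta>. (-1) ^ (N - 1 - i) * (X ^^ (N - 1 - i)) v \<zeta>) z \<zeta> = (\<Sum>i<N. ?g (Suc i) z \<zeta>)"
      unfolding tens_def by (rule sum.cong) auto
    moreover have "tens {..<N} (\<lambda>i. (X ^^ i) u)
        (\<lambda>i. X (\<lambda>\<zeta>. (-1) ^ (N - 1 - i) * (X ^^ (N - 1 - i)) v \<zeta>)) z \<zeta> = (\<Sum>i<N. - ?g i z \<zeta>)"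
      unfolding tens_def
    proof (rule sum.cong)
      fix i assume "i \<in> {..<N}"
      then have "N - i = Suc (N - 1 - i)" by auto
      then show "(X ^^ i) u z * cnj (X (\<lambda>\<zeta>. (-1) ^ (N - 1 - i) * (X ^^ (N - 1 - i)) v \<zeta>) \<zeta>)
          = - ?g i z \<zeta>"
        by (simp add: X_scale[OF Wv])
    qed simp
    moreover have "(\<Sum>i<N. ?g (Suc i) z \<zeta>) - (\<Sum>i<N. ?g i z \<zeta>) = ?g N z \<zeta> - ?g 0 z \<zeta>"
      unfolding sum_subtractf[symmetric] by (rule sum_lessThan_telescope)
    moreover have "?g N z \<zeta> = 0" "?g 0 z \<zeta> = 0" using Xu Xv by auto
    ultimately show ?thesis
      by (simp only: sum_negf add_uminus_conv_diff diff_self)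
  qed
  moreover have "W ((X ^^ i) u)" "W (\<lambda>\<zeta>. (-1) ^ (N - 1 - i) * (X ^^ (N - 1 - i)) v \<zeta>)" for i
    using H_W[OF H_funpow[OF H(1)]] W_scale Wv by auto
  ultimately show ?thesis
    unfolding chain_tensor_def by (subst invariant_tens_iff) auto
qed

text \<open>Complementary weights make every summand of the tensor homogeneous of total weight
  \<open>\<tau>\<close>. One weight function serves both factors, so exchanging them just replaces
  \<open>\<kappa>\<close> by \<open>\<tau> - \<kappa>\<close>.\<close>

definition graded_family ::
    "rat \<Rightarrow> 'i set \<Rightarrow> ('i \<Rightarrow> rat) \<Rightarrow> ('i \<Rightarrow> 'p \<Rightarrow> complex) \<Rightarrow> ('i \<Rightarrow> 'p \<Rightarrow> complex) \<Rightarrow> bool" where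
  "graded_family \<tau> I \<kappa> a b \<longleftrightarrow> finite I \<and> (\<forall>i\<in>I. H (\<kappa> i) (a i) \<and> H (\<tau> - \<kappa> i) (b i))"

text \<open>The relation is solved for \<open>a q\<close>, and the summand of \<open>q\<close> is
  redistributed over the other \<open>b i\<close>; coefficients get conjugated on the way into the
  second factor. Only the \<open>b i\<close> of the same weight as \<open>b q\<close> change, so the
  grading survives.\<close>

lemma tens_reduce_left:
  assumes gr: "graded_family \<tau> I \<kappa> a b" and q: "q \<in> I" "d q \<noteq> 0"
    and rel: "\<And>z. (\<Sum>i\<in>I. d i * a i z) = 0" and d: "\<And>i. i \<in> I \<Longrightarrow> d i \<noteq> 0 \<Longrightarrow> \<kappa> i = \<kappa> q"
  shows "\<exists>b'. graded_family \<tau> (I - {q}) \<kappa> a b' \<and> tens I a b = tens (I - {q}) a b'"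
proof -
  have fin: "finite I" using gr unfolding graded_family_def by blast
  define b' where "b' i = (\<lambda>\<zeta>. b i \<zeta> + (- cnj (d i / d q)) * b q \<zeta>)" for i
  have "H (\<tau> - \<kappa> i) (b' i)" if "i \<in> I" for i
  proof (cases "d i = 0")
    case True
    then show ?thesis using gr that unfolding b'_def graded_family_def by simp
  next
    case False
    have "H (\<tau> - \<kappa> i) (b q)" "H (\<tau> - \<kappa> i) (b i)"
      using d[OF that False] gr q that unfolding graded_family_def by auto
    then show ?thesis unfolding b'_def by (intro H_add H_scale)
  qed
  then have "graded_family \<tau> (I - {q}) \<kappa> a b'"
    using gr unfolding graded_family_def by auto
  moreover have "tens I a b z \<zeta> = tens (I - {q}) a b' z \<zeta>" for z \<zeta>
  proof -
    have *: "a q z = - (\<Sum>i\<in>I - {q}. d i / d q * a i z)"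
    proof -
      have "d q * a q z + (\<Sum>i\<in>I - {q}. d i * a i z) = 0"
        using rel[of z] sum.remove[OF fin q(1), of "\<lambda>i. d i * a i z"] by simp
      then have "a q z = - (\<Sum>i\<in>I - {q}. d i * a i z) / d q"
        using q(2) by (simp add: field_simps eq_neg_iff_add_eq_0)
      then show ?thesis by (simp add: sum_divide_distrib)
    qed
    have "tens I a b z \<zeta> = a q z * cnj (b q \<zeta>) + (\<Sum>i\<in>I - {q}. a i z * cnj (b i \<zeta>))"
      unfolding tens_def by (rule sum.remove[OF fin q(1)])
    also have "\<dots> = tens (I - {q}) a b' z \<zeta>"
      unfolding tens_def b'_def *
      by (simp add: algebra_simps sum.distrib sum_distrib_left sum_distrib_right sum_subtractf sum_negf)
    finally show ?thesis .
  qed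
  ultimately show ?thesis by blast
qed

lemma tens_swap: "tens I a b z \<zeta> = cnj (tens I b a \<zeta> z)"
  unfolding tens_def by (simp add: mult.commute)

lemma graded_family_swap:
  "graded_family \<tau> I (\<lambda>i. \<tau> - \<kappa> i) b a \<longleftrightarrow> graded_family \<tau> I \<kappa> a b"
  unfolding graded_family_def by auto

text \<open>An arbitrary relation is first cut down to its part in one weight, the weight of a
  \<open>q\<close> with nonzero coefficient, since the reduction preserves the grading only for
  homogeneous relations.\<close>

lemma tens_reduce_dependent:
  assumes gr: "graded_family \<tau> I \<kappa> a b" and dep: "\<not> lin_indep I a"
  shows "\<exists>q b'. q \<in> I \<and> graded_family \<tau> (I - {q}) \<kappa> a b' \<and> tens I a b = tens (I - {q}) a b'"
proof -
  obtain c q where c: "\<And>z. (\<Sum>i\<in>I. c i * a i z) = 0" and q: "q \<in> I" "c q \<noteq> 0"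
    using dep unfolding lin_indep_def by blast
  have fin: "finite I" using gr unfolding graded_family_def by blast
  have "(\<Sum>i\<in>I. (if \<kappa> i = \<kappa> q then c i else 0) * a i z) = 0" for z
  proof -
    have "(\<Sum>i | i \<in> I \<and> \<kappa> i = \<kappa> q. c i * a i z) = 0"
      by (rule separate_sum) (use gr c in \<open>auto simp: graded_family_def\<close>)
    moreover have "(\<Sum>i\<in>I. (if \<kappa> i = \<kappa> q then c i else 0) * a i z)
        = (\<Sum>i | i \<in> I \<and> \<kappa> i = \<kappa> q. c i * a i z)"
      by (rule sum.mono_neutral_cong_right) (use fin in auto)
    ultimately show ?thesis by simp
  qed
  from tens_reduce_left[OF gr q(1) _ this] q show ?thesis by (auto split: if_splits)
qed

text \<open>In the equation \<Sum> X a_k cnj b_k = - \<Sum> a_k cnj (X b_k), the functional dual to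
  b_i, applied in \<open>\<zeta>\<close>, isolates X a_i as a combination of the a_k. Inserting this
  and comparing coefficients of the independent a_j yields the action on the b_i.\<close>

lemma invariant_matrix:
  assumes gr: "graded_family \<tau> I \<kappa> a b" and ind: "lin_indep I a" "lin_indep I b"
    and inv: "invariant_tensor (tens I a b)"
  shows "\<exists>m. \<forall>i\<in>I. X (a i) = (\<lambda>z. \<Sum>j\<in>I. m i j * a j z) \<and>
           X (b i) = (\<lambda>\<zeta>. \<Sum>j\<in>I. - cnj (m j i) * b j \<zeta>)"
proof -
  have fin: "finite I" and W: "\<And>i. i \<in> I \<Longrightarrow> W (a i)" "\<And>i. i \<in> I \<Longrightarrow> W (b i)"
    using gr H_W unfolding graded_family_def by blast+
  have eq: "(\<Sum>i\<in>I. X (a i) z * cnj (b i \<zeta>)) = - (\<Sum>i\<in>I. a i z * cnj (X (b i) \<zeta>))" for z \<zeta>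
    using iffD1[OF invariant_tens_iff[OF fin W] inv] unfolding tens_def
    by (simp add: eq_neg_iff_add_eq_0)
  obtain L where L: "\<And>i. i \<in> I \<Longrightarrow> eval_comb (L i)"
    "\<And>i k. i \<in> I \<Longrightarrow> k \<in> I \<Longrightarrow> L i (b k) = (if k = i then 1 else 0)"
    using dual_functionals[OF fin ind(2)] by blast
  define m where "m i j = - cnj (L i (X (b j)))" for i j
  have Xa: "X (a i) z = (\<Sum>j\<in>I. m i j * a j z)" if i: "i \<in> I" for i z
  proof -
    \<comment> \<open>The functionals are linear in the \<open>b k\<close> themselves, so the
      equation is conjugated before they are applied.\<close>
    have "cnj (\<Sum>k\<in>I. X (a k) z * cnj (b k \<zeta>)) = cnj (- (\<Sum>k\<in>I. a k z * cnj (X (b k) \<zeta>)))" for \<zeta>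
      using eq by simp
    then have "(\<lambda>\<zeta>. \<Sum>k\<in>I. cnj (X (a k) z) * b k \<zeta>) = (\<lambda>\<zeta>. \<Sum>k\<in>I. (- cnj (a k z)) * X (b k) \<zeta>)"
      by (intro ext) (simp add: sum_negf)
    then have "(\<Sum>k\<in>I. cnj (X (a k) z) * L i (b k)) = (\<Sum>k\<in>I. (- cnj (a k z)) * L i (X (b k)))"
      using eval_comb_lin[OF L(1)[OF i], of "\<lambda>k. cnj (X (a k) z)" b I]
        eval_comb_lin[OF L(1)[OF i], of "\<lambda>k. - cnj (a k z)" "\<lambda>k. X (b k)" I] by simp
    moreover have "(\<Sum>k\<in>I. cnj (X (a k) z) * L i (b k)) = (\<Sum>k\<in>I. if k = i then cnj (X (a k) z) else 0)"
      by (rule sum.cong) (use L(2)[OF i] in auto)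
    ultimately have "cnj (X (a i) z) = (\<Sum>k\<in>I. (- cnj (a k z)) * L i (X (b k)))"
      using fin i by simp
    then have "X (a i) z = cnj (\<Sum>k\<in>I. (- cnj (a k z)) * L i (X (b k)))"
      by (metis complex_cnj_cnj)
    then show ?thesis unfolding m_def by (simp add: mult.commute)
  qed
  have Xb: "X (b i) \<zeta> = (\<Sum>j\<in>I. - cnj (m j i) * b j \<zeta>)" if i: "i \<in> I" for i \<zeta>
  proof -
    have "(\<Sum>j\<in>I. (\<Sum>k\<in>I. m k j * cnj (b k \<zeta>)) * a j z) = (\<Sum>j\<in>I. (- cnj (X (b j) \<zeta>)) * a j z)" for z
    proof -
      have "(\<Sum>j\<in>I. (\<Sum>k\<in>I. m k j * cnj (b k \<zeta>)) * a j z)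
          = (\<Sum>k\<in>I. (\<Sum>j\<in>I. m k j * a j z) * cnj (b k \<zeta>))"
        unfolding sum_distrib_right by (subst sum.swap) (simp add: mult_ac)
      also have "\<dots> = (\<Sum>k\<in>I. X (a k) z * cnj (b k \<zeta>))"
        by (rule sum.cong) (simp_all add: Xa)
      finally show ?thesis using eq[of z \<zeta>] by (simp add: sum_negf mult.commute)
    qed
    from lin_indep_eqD[OF ind(1) this i]
    have "- cnj (X (b i) \<zeta>) = (\<Sum>k\<in>I. m k i * cnj (b k \<zeta>))" by simp
    then have "X (b i) \<zeta> = - cnj (\<Sum>k\<in>I. m k i * cnj (b k \<zeta>))"
      by (metis complex_cnj_cnj complex_cnj_minus minus_equation_iff)
    then show ?thesis by (simp add: sum_negf)
  qed
  show ?thesis using Xa Xb by blast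
qed

text \<open>\<open>m\<close> is the k-th power of the matrix of X on the \<open>a i\<close>; the
  action on the \<open>b i\<close> is the adjoint with sign (-1)^k.\<close>

lemma invariant_matrix_powers:
  assumes gr: "graded_family \<tau> I \<kappa> a b" and ind: "lin_indep I a" "lin_indep I b"
    and inv: "invariant_tensor (tens I a b)"
  shows "\<exists>m. \<forall>i\<in>I. (X ^^ k) (a i) = (\<lambda>z. \<Sum>j\<in>I. m i j * a j z) \<and>
           (X ^^ k) (b i) = (\<lambda>\<zeta>. \<Sum>j\<in>I. (-1) ^ k * cnj (m j i) * b j \<zeta>)"
proof (induction k)
  case 0
  have "finite I" using gr unfolding graded_family_def by blast
  then show ?case
    by (intro exI[of _ "\<lambda>i j. if i = j then 1 else 0"] ballI conjI ext)
      (simp_all add: if_distrib if_distribR cong: if_cong)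
next
  case (Suc k)
  have fin: "finite I" and H: "\<And>i. i \<in> I \<Longrightarrow> H (\<kappa> i) (a i)"
    and W: "\<And>i. i \<in> I \<Longrightarrow> W (b i)"
    using gr H_W unfolding graded_family_def by blast+
  from Suc obtain m where m: "\<And>i. i \<in> I \<Longrightarrow> (X ^^ k) (a i) = (\<lambda>z. \<Sum>j\<in>I. m i j * a j z)"
    "\<And>i. i \<in> I \<Longrightarrow> (X ^^ k) (b i) = (\<lambda>\<zeta>. \<Sum>j\<in>I. (-1) ^ k * cnj (m j i) * b j \<zeta>)"
    by blast
  obtain n where n: "\<And>i. i \<in> I \<Longrightarrow> X (a i) = (\<lambda>z. \<Sum>j\<in>I. n i j * a j z)"
    "\<And>i. i \<in> I \<Longrightarrow> X (b i) = (\<lambda>\<zeta>. \<Sum>j\<in>I. - cnj (n j i) * b j \<zeta>)"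
    using invariant_matrix[OF gr ind inv] by blast
  let ?mn = "\<lambda>i j. \<Sum>l\<in>I. n i l * m l j"
  have "(X ^^ Suc k) (a i) z = (\<Sum>j\<in>I. ?mn i j * a j z)" if i: "i \<in> I" for i z
  proof -
    \<comment> \<open>The new factor is applied first here but last for \<open>b\<close> below.
      Since adjoints reverse products, both sides then produce the same matrix \<open>?mn\<close>,
      and no commutation is required.\<close>
    have "(X ^^ Suc k) (a i) = (X ^^ k) (X (a i))" by (simp add: funpow_swap1)
    also have "\<dots> = (\<lambda>z. \<Sum>l\<in>I. n i l * (X ^^ k) (a l) z)"
      unfolding n(1)[OF i] by (rule X_funpow_sum[OF fin H])
    finally have "(X ^^ Suc k) (a i) z = (\<Sum>l\<in>I. n i l * (\<Sum>j\<in>I. m l j * a j z))"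
      by (simp add: m(1))
    also have "\<dots> = (\<Sum>j\<in>I. ?mn i j * a j z)"
      unfolding sum_distrib_left sum_distrib_right by (subst sum.swap) (simp add: mult_ac)
    finally show ?thesis .
  qed
  moreover have "(X ^^ Suc k) (b i) \<zeta> = (\<Sum>j\<in>I. (-1) ^ Suc k * cnj (?mn j i) * b j \<zeta>)"
    if i: "i \<in> I" for i \<zeta>
  proof -
    have "(X ^^ Suc k) (b i) = X (\<lambda>\<zeta>. \<Sum>j\<in>I. (-1) ^ k * cnj (m j i) * b j \<zeta>)"
      by (simp add: m(2)[OF i])
    also have "\<dots> = (\<lambda>\<zeta>. \<Sum>l\<in>I. (-1) ^ k * cnj (m l i) * X (b l) \<zeta>)"
      by (rule X_sum[OF fin W])
    finally have "(X ^^ Suc k) (b i) \<zeta>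
        = (\<Sum>l\<in>I. (-1) ^ k * cnj (m l i) * (\<Sum>j\<in>I. - cnj (n j l) * b j \<zeta>))"
      by (simp add: n(2))
    also have "\<dots> = (\<Sum>j\<in>I. (-1) ^ Suc k * cnj (?mn j i) * b j \<zeta>)"
      unfolding sum_distrib_left sum_distrib_right cnj_sum
      by (subst sum.swap) (simp add: mult_ac sum_distrib_left sum_distrib_right sum_negf)
    finally show ?thesis .
  qed
  ultimately show ?case by (intro exI[of _ ?mn]) blast
qed

text \<open>X^N raises weights by N \<open>\<nu>\<close>, yet X^N a_i stays in the span of the a_j,
  whose weights differ by a bounded amount. For large N all coefficients must vanish.\<close>

lemma X_nilpotent_on_family:
  assumes gr: "graded_family \<tau> I \<kappa> a b" and ind: "lin_indep I a" "lin_indep I b"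
    and inv: "invariant_tensor (tens I a b)"
  shows "\<exists>N. \<forall>i\<in>I. (X ^^ N) (a i) = (\<lambda>_. 0)"
proof -
  have fin: "finite I" and H: "\<And>i. i \<in> I \<Longrightarrow> H (\<kappa> i) (a i)"
    using gr unfolding graded_family_def by blast+
  \<comment> \<open>The sum of all differences is a crude bound for each single one.\<close>
  obtain N :: nat where N: "(\<Sum>i\<in>I. \<Sum>j\<in>I. \<bar>\<kappa> i - \<kappa> j\<bar>) < of_nat N * \<nu>"
    using ex_less_of_nat_mult[OF \<nu>_pos] by blast
  obtain m where m: "\<And>i. i \<in> I \<Longrightarrow> (X ^^ N) (a i) = (\<lambda>z. \<Sum>j\<in>I. m i j * a j z)"
    using invariant_matrix_powers[OF gr ind inv, of N] by blast
  have "m i j = 0" if ij: "i \<in> I" "j \<in> I" for i j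
  proof (rule ccontr)
    assume "m i j \<noteq> 0"
    then have "\<kappa> j = \<kappa> i + of_nat N * \<nu>"
      using combination_weight[OF fin H ind(1) H_funpow[OF H[OF ij(1)], of N], of "m i" j]
        m[OF ij(1)] ij(2) by auto
    then have "of_nat N * \<nu> \<le> \<bar>\<kappa> i - \<kappa> j\<bar>" by simp
    also have "\<dots> \<le> (\<Sum>j\<in>I. \<bar>\<kappa> i - \<kappa> j\<bar>)"
      by (rule member_le_sum) (use fin ij in auto)
    also have "\<dots> \<le> (\<Sum>i\<in>I. \<Sum>j\<in>I. \<bar>\<kappa> i - \<kappa> j\<bar>)"
      by (rule member_le_sum[where f="\<lambda>i. \<Sum>j\<in>I. \<bar>\<kappa> i - \<kappa> j\<bar>"]) (use fin ij in \<open>auto intro: sum_nonneg\<close>)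
    finally show False using N by simp
  qed
  then show ?thesis by (intro exI[of _ N]) (simp add: m)
qed

text \<open>Here \<open>m k\<close> is C^k, but each \<open>m k\<close> is chosen separately;
  multiplicativity and vanishing of these matrices are recovered from the independence of
  \<open>a\<close>.\<close>

lemma tens_split_chain:
  assumes gr: "graded_family \<tau> I \<kappa> a b" and ind: "lin_indep I a" "lin_indep I b"
    and inv: "invariant_tensor (tens I a b)" and ne: "I \<noteq> {}"
  shows "\<exists>c q a' b'. chain_data c \<and> q \<in> I \<and> graded_family \<tau> (I - {q}) \<kappa> a' b' \<and>
    (\<forall>z \<zeta>. tens I a b z \<zeta> =
       tens (I - {q}) a' b' z \<zeta> + (case c of (N, u, v) \<Rightarrow> chain_tensor N u v z \<zeta>))"
proof -
  have fin: "finite I" and Ha: "\<And>i. i \<in> I \<Longrightarrow> H (\<kappa> i) (a i)"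
    and Hb: "\<And>i. i \<in> I \<Longrightarrow> H (\<tau> - \<kappa> i) (b i)"
    using gr unfolding graded_family_def by blast+
  have "\<forall>k. \<exists>m. \<forall>i\<in>I. (X ^^ k) (a i) = (\<lambda>z. \<Sum>j\<in>I. m i j * a j z) \<and>
           (X ^^ k) (b i) = (\<lambda>\<zeta>. \<Sum>j\<in>I. (-1) ^ k * cnj (m j i) * b j \<zeta>)"
    using invariant_matrix_powers[OF gr ind inv] by blast
  then obtain m where
    ma: "\<And>k i. i \<in> I \<Longrightarrow> (X ^^ k) (a i) = (\<lambda>z. \<Sum>j\<in>I. m k i j * a j z)" and
    mb: "\<And>k i. i \<in> I \<Longrightarrow> (X ^^ k) (b i) = (\<lambda>\<zeta>. \<Sum>j\<in>I. (-1) ^ k * cnj (m k j i) * b j \<zeta>)"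
    using choice[of "\<lambda>k m. \<forall>i\<in>I. (X ^^ k) (a i) = (\<lambda>z. \<Sum>j\<in>I. m i j * a j z) \<and>
           (X ^^ k) (b i) = (\<lambda>\<zeta>. \<Sum>j\<in>I. (-1) ^ k * cnj (m j i) * b j \<zeta>)"] by blast
  \<comment> \<open>A nonzero entry of C^k joins only indices whose weights differ by k
    \<open>\<nu>\<close>. This keeps \<open>a'\<close> graded and makes the final relation
    homogeneous.\<close>
  have weight: "\<kappa> j = \<kappa> i + of_nat k * \<nu>" if "i \<in> I" "j \<in> I" "m k i j \<noteq> 0" for i j k
    using combination_weight[OF fin Ha ind(1) H_funpow[OF Ha[OF that(1)], of k], of "m k i" j]
      ma[OF that(1)] that by auto
  define N where "N = (LEAST N. \<forall>i\<in>I. (X ^^ N) (a i) = (\<lambda>_. 0))"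
  have N: "(X ^^ N) (a i) = (\<lambda>_. 0)" if "i \<in> I" for i
    using LeastI_ex[OF X_nilpotent_on_family[OF gr ind inv]] that unfolding N_def by blast
  have N_pos: "0 < N"
  proof (rule ccontr)
    assume "\<not> 0 < N"
    then have a0: "a i = (\<lambda>_. 0)" if "i \<in> I" for i using N[OF that] by simp
    obtain i where "i \<in> I" using ne by blast
    from lin_indepD[OF ind(1) _ this, of "\<lambda>_. 1"] show False by (simp add: a0)
  qed
  then obtain p where p: "p \<in> I" "(X ^^ (N - 1)) (a p) \<noteq> (\<lambda>_. 0)"
    using not_less_Least[of "N - 1" "\<lambda>N. \<forall>i\<in>I. (X ^^ N) (a i) = (\<lambda>_. 0)"]
    unfolding N_def[symmetric] by fastforce
  then obtain q where q: "q \<in> I" "m (N - 1) p q \<noteq> 0"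
    using ma[OF p(1), of "N - 1"] by (metis (no_types, lifting) mult_eq_0_iff sum.neutral)
  define c where "c = m (N - 1) p q"
  have c: "c \<noteq> 0" using q c_def by simp
  \<comment> \<open>C^k = 0 for k at least N: the coefficients of X^k a_i = 0 are unique.\<close>
  have m0: "m k i j = 0" if "i \<in> I" "j \<in> I" "N \<le> k" for i j k
  proof -
    have "(X ^^ k) (a i) = (X ^^ (k - N)) ((X ^^ N) (a i))"
      using that(3) by (metis comp_apply funpow_add le_add_diff_inverse2)
    then have "(\<lambda>z. \<Sum>j\<in>I. m k i j * a j z) = (\<lambda>_. 0)"
      using ma[OF that(1), of k] N[OF that(1)] X_funpow_zero by simp
    then have "(\<Sum>j\<in>I. m k i j * a j z) = 0" for z by (rule fun_cong)
    from lin_indepD[OF ind(1) this that(2)] show ?thesis .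
  qed
  \<comment> \<open>C^(N-1) C^k = C^(N-1+k) by uniqueness of coefficients; this vanishes for every
    positive k, as the exponent is then at least N.\<close>
  have prod: "(\<Sum>i\<in>I. m (N - 1) p i * m k i j) = (if k = 0 then m (N - 1) p j else 0)" if j: "j \<in> I" for k j
  proof -
    have "(X ^^ (k + (N - 1))) (a p) = (\<lambda>z. \<Sum>i\<in>I. m (N - 1) p i * (X ^^ k) (a i) z)"
      unfolding funpow_add comp_def ma[OF p(1), of "N - 1"] by (rule X_funpow_sum[OF fin Ha])
    then have "(\<Sum>j\<in>I. m (k + (N - 1)) p j * a j z)
        = (\<Sum>i\<in>I. m (N - 1) p i * (\<Sum>j\<in>I. m k i j * a j z))" for z
      using ma[OF p(1), of "k + (N - 1)"] by (simp add: ma fun_eq_iff)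
    also have "\<dots> z = (\<Sum>j\<in>I. (\<Sum>i\<in>I. m (N - 1) p i * m k i j) * a j z)" for z
      unfolding sum_distrib_left sum_distrib_right by (subst sum.swap) (simp add: mult_ac)
    finally have "m (k + (N - 1)) p j = (\<Sum>i\<in>I. m (N - 1) p i * m k i j)"
      by (rule lin_indep_eqD[OF ind(1) _ j])
    moreover have "k \<noteq> 0 \<Longrightarrow> m (k + (N - 1)) p j = 0"
      using m0[OF p(1) j] N_pos by simp
    ultimately show ?thesis by auto
  qed
  define u where "u = a p"
  define v where "v = (\<lambda>\<zeta>. cnj (1 / c) * b q \<zeta>)"
  have Xv: "(X ^^ k) v = (\<lambda>\<zeta>. cnj (1 / c) * (X ^^ k) (b q) \<zeta>)" for k
    unfolding v_def by (rule X_funpow_scale[OF Hb[OF q(1)]])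
  have chain: "chain_data (N, u, v)"
  proof -
    have "H (\<kappa> p) u" "H (\<tau> - \<kappa> q) v"
      unfolding u_def v_def using Ha[OF p(1)] H_scale[OF Hb[OF q(1)]] by blast+
    moreover have "(X ^^ N) v = (\<lambda>_. 0)" unfolding Xv by (simp add: mb[OF q(1)] m0[OF _ q(1)])
    ultimately show ?thesis using N_pos N[OF p(1)] unfolding chain_data_def u_def by auto
  qed
  \<comment> \<open>The chain tensor is expanded over the same second factors \<open>b i\<close>,
    its signs cancelling those of X^k b_q; what then multiplies \<open>cnj (b i)\<close> is taken
    off \<open>a i\<close>.\<close>
  define a' where "a' i z = a i z - (1 / c) * (\<Sum>k<N. m (N - 1 - k) i q * (X ^^ k) u z)" for i z
  have split: "tens I a b z \<zeta> = tens I a' b z \<zeta> + chain_tensor N u v z \<zeta>" for z \<zeta>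
  proof -
    have sq: "(-1) ^ k * ((-1) ^ k * x) = x" for k and x :: complex
      by (simp flip: mult.assoc power_mult_distrib)
    have v: "cnj ((-1) ^ k * (X ^^ k) v \<zeta>) = (1 / c) * (\<Sum>i\<in>I. m k i q * cnj (b i \<zeta>))" for k
    proof -
      have "(-1) ^ k * (X ^^ k) v \<zeta> = cnj (1 / c) * (\<Sum>i\<in>I. (-1) ^ k * ((-1) ^ k * (cnj (m k i q) * b i \<zeta>)))"
        unfolding Xv mb[OF q(1)] by (simp only: sum_distrib_left mult.assoc mult.left_commute)
      then show ?thesis by (simp add: sq)
    qed
    have "chain_tensor N u v z \<zeta> =
        (\<Sum>k<N. (X ^^ k) u z * (1 / c) * (\<Sum>i\<in>I. m (N - 1 - k) i q * cnj (b i \<zeta>)))"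
      unfolding chain_tensor_def tens_def v by (simp only: mult.assoc)
    also have "\<dots> = (\<Sum>i\<in>I. (1 / c) * (\<Sum>k<N. m (N - 1 - k) i q * (X ^^ k) u z) * cnj (b i \<zeta>))"
      unfolding sum_distrib_left sum_distrib_right by (subst sum.swap) (simp add: mult_ac)
    finally show ?thesis
      unfolding tens_def a'_def by (simp add: left_diff_distrib sum_subtractf)
  qed
  \<comment> \<open>A nonzero coefficient of X^k u gives \<open>\<kappa> q\<close> =
    \<open>\<kappa> i\<close> + (N-1-k) \<open>\<nu>\<close>, while c \<noteq> 0 gives
    \<open>\<kappa> q\<close> = \<open>\<kappa> p\<close> + (N-1) \<open>\<nu>\<close>. Hence
    \<open>\<kappa> i\<close> = \<open>\<kappa> p\<close> + k \<open>\<nu>\<close>, the weight of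
    X^k u.\<close>
  have "H (\<kappa> i) (a' i)" if i: "i \<in> I" for i
  proof -
    have "H (\<kappa> i) (\<lambda>z. \<Sum>k<N. m (N - 1 - k) i q * (X ^^ k) u z)"
    proof (rule H_sum)
      fix k assume "k \<in> {..<N}" "m (N - 1 - k) i q \<noteq> 0"
      then have "\<kappa> q = \<kappa> i + of_nat (N - 1 - k) * \<nu>" "N - 1 = (N - 1 - k) + k"
        using weight[OF i q(1)] by auto
      moreover from this(2) have "of_nat (N - 1) = (of_nat (N - 1 - k) + of_nat k :: rat)"
        by (metis of_nat_add)
      moreover have "\<kappa> q = \<kappa> p + of_nat (N - 1) * \<nu>" using weight[OF p(1) q(1,2)] .
      ultimately have "\<kappa> i = \<kappa> p + of_nat k * \<nu>"
        by (simp add: distrib_right)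
      then show "H (\<kappa> i) ((X ^^ k) u)"
        unfolding u_def using H_funpow[OF Ha[OF p(1)]] by simp
    qed simp
    from H_add[OF Ha[OF i] H_scale[OF this, of "- (1 / c)"]]
    show ?thesis unfolding a'_def[abs_def] by simp
  qed
  then have gr': "graded_family \<tau> I \<kappa> a' b" using gr unfolding graded_family_def by blast
  have rel: "(\<Sum>i\<in>I. m (N - 1) p i * a' i z) = 0" for z
  proof -
    have "(\<Sum>i\<in>I. m (N - 1) p i * (\<Sum>k<N. m (N - 1 - k) i q * (X ^^ k) u z))
        = (\<Sum>k<N. (\<Sum>i\<in>I. m (N - 1) p i * m (N - 1 - k) i q) * (X ^^ k) u z)"
      unfolding sum_distrib_left sum_distrib_right by (subst sum.swap) (simp add: mult_ac)
    also have "\<dots> = (\<Sum>k<N. if k = N - 1 then c * (X ^^ (N - 1)) u z else 0)"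
      unfolding prod[OF q(1)] by (rule sum.cong) (auto simp: c_def)
    also have "\<dots> = c * (\<Sum>i\<in>I. m (N - 1) p i * a i z)"
      using N_pos fun_cong[OF ma[OF p(1), of "N - 1"], of z] by (simp add: u_def)
    finally have "(\<Sum>i\<in>I. m (N - 1) p i * (\<Sum>k<N. m (N - 1 - k) i q * (X ^^ k) u z))
        = c * (\<Sum>i\<in>I. m (N - 1) p i * a i z)" .
    moreover have "1 / c * c = 1" using c by simp
    ultimately show ?thesis
      unfolding a'_def
      by (simp add: right_diff_distrib sum_subtractf sum_distrib_left[symmetric]
          mult.left_commute[of _ "1 / c"] del: times_divide_eq_left times_divide_eq_right)
  qed
  have "\<kappa> i = \<kappa> q" if "i \<in> I" "m (N - 1) p i \<noteq> 0" for i
    using weight[OF p(1) that] weight[OF p(1) q] by simp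
  from tens_reduce_left[OF gr' q(1), of "m (N - 1) p", OF q(2) rel this]
  obtain b' where "graded_family \<tau> (I - {q}) \<kappa> a' b'" "tens I a' b = tens (I - {q}) a' b'"
    by blast
  then show ?thesis
    using chain q(1) split by (intro exI[of _ "(N, u, v)"] exI[of _ q] exI[of _ a'] exI[of _ b']) auto
qed

lemma invariant_tensor_diff:
  assumes "finite I" "\<And>i. i \<in> I \<Longrightarrow> W (a i)" "\<And>i. i \<in> I \<Longrightarrow> W (b i)"
    and "finite J" "\<And>i. i \<in> J \<Longrightarrow> W (a' i)" "\<And>i. i \<in> J \<Longrightarrow> W (b' i)"
    and "invariant_tensor (\<lambda>z \<zeta>. tens I a b z \<zeta> + tens J a' b' z \<zeta>)"
    and "invariant_tensor (tens J a' b')"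
  shows "invariant_tensor (tens I a b)"
  unfolding invariant_tensor_def
proof (intro allI)
  fix z \<zeta>
  have "(X (\<lambda>z. tens I a b z \<zeta>) z + X (\<lambda>z. tens J a' b' z \<zeta>) z)
      + (cnj (X (\<lambda>\<zeta>. cnj (tens I a b z \<zeta>)) \<zeta>) + cnj (X (\<lambda>\<zeta>. cnj (tens J a' b' z \<zeta>)) \<zeta>)) = 0"
    using assms(7) unfolding invariant_tensor_def complex_cnj_add
    by (simp add: X_add W_tens assms(1-6))
  moreover have "X (\<lambda>z. tens J a' b' z \<zeta>) z + cnj (X (\<lambda>\<zeta>. cnj (tens J a' b' z \<zeta>)) \<zeta>) = 0"
    using assms(8) unfolding invariant_tensor_def by blast
  ultimately show "X (\<lambda>z. tens I a b z \<zeta>) z + cnj (X (\<lambda>\<zeta>. cnj (tens I a b z \<zeta>)) \<zeta>) = 0"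
    by (simp add: add_ac)
qed

text \<open>Discarding a dependent summand changes the presentation but not the function
  \<open>tens I a b\<close>, so invariance is inherited. After splitting off a chain it passes to
  the remainder because the chain tensor is itself invariant. In every nonempty case one index
  disappears.\<close>

lemma chain_decomposition:
  assumes "graded_family \<tau> I \<kappa> a b" "invariant_tensor (tens I a b)"
  shows "\<exists>R. (\<forall>c\<in>set R. chain_data c) \<and>
    (\<forall>z \<zeta>. tens I a b z \<zeta> = (\<Sum>(N, u, v)\<leftarrow>R. chain_tensor N u v z \<zeta>))"
  using assms
proof (induction "card I" arbitrary: I a b rule: less_induct)
  case less
  note gr = less.prems(1) and inv = less.prems(2)
  have fin: "finite I" using gr unfolding graded_family_def by blast
  have smaller: "card (I - {q}) < card I" if "q \<in> I" for q
    using card_Diff1_less[OF fin that] .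
  consider "I = {}" | "\<not> lin_indep I a" | "\<not> lin_indep I b" | "I \<noteq> {}" "lin_indep I a" "lin_indep I b"
    by blast
  then show ?case
  proof cases
    case 1
    then show ?thesis by (intro exI[of _ "[]"]) (simp add: tens_def)
  next
    case 2
    from tens_reduce_dependent[OF gr this] obtain q b' where
      "q \<in> I" "graded_family \<tau> (I - {q}) \<kappa> a b'" "tens I a b = tens (I - {q}) a b'" by blast
    then show ?thesis using less.hyps[OF smaller, of q a b'] inv by metis
  next
    case 3
    \<comment> \<open>Conjugate symmetry of \<open>tens\<close> lets the reduction of the first
      factor serve for the second.\<close>
    from tens_reduce_dependent[OF graded_family_swap[THEN iffD2, OF gr] this]
    obtain q a' where q: "q \<in> I" "graded_family \<tau> (I - {q}) (\<lambda>i. \<tau> - \<kappa> i) b a'"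
      "tens I b a = tens (I - {q}) b a'" by blast
    then have "graded_family \<tau> (I - {q}) \<kappa> a' b" by (simp add: graded_family_swap)
    moreover have "tens I a b = tens (I - {q}) a' b"
      by (intro ext) (subst (1 2) tens_swap, simp add: q(3))
    ultimately show ?thesis using less.hyps[OF smaller[OF q(1)], of a' b] inv by metis
  next
    case 4
    from tens_split_chain[OF gr 4(2,3) inv 4(1)] obtain N u v q a' b' where
      c: "chain_data (N, u, v)" and q: "q \<in> I" and gr': "graded_family \<tau> (I - {q}) \<kappa> a' b'" and
      eq: "\<And>z \<zeta>. tens I a b z \<zeta> = tens (I - {q}) a' b' z \<zeta> + chain_tensor N u v z \<zeta>"
      by (auto split: prod.splits)
    obtain k l where H: "H k u" "H l v" using c unfolding chain_data_def by auto
    have "invariant_tensor (tens (I - {q}) a' b')"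
    proof (rule invariant_tensor_diff)
      show "invariant_tensor (tens {..<N} (\<lambda>k. (X ^^ k) u)
          (\<lambda>k \<zeta>. (-1) ^ (N - 1 - k) * (X ^^ (N - 1 - k)) v \<zeta>))"
        using invariant_chain_tensor[OF c] unfolding chain_tensor_def .
      show "invariant_tensor (\<lambda>z \<zeta>. tens (I - {q}) a' b' z \<zeta> + tens {..<N} (\<lambda>k. (X ^^ k) u)
          (\<lambda>k \<zeta>. (-1) ^ (N - 1 - k) * (X ^^ (N - 1 - k)) v \<zeta>) z \<zeta>)"
        unfolding chain_tensor_def[symmetric] eq[symmetric] using inv by simp
      show "finite (I - {q})" "\<And>i. i \<in> I - {q} \<Longrightarrow> W (a' i)" "\<And>i. i \<in> I - {q} \<Longrightarrow> W (b' i)"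
        using gr' H_W unfolding graded_family_def by blast+
    qed (use H_W[OF H_funpow[OF H(1)]] H_W[OF H_scale[OF H_funpow[OF H(2)]]] in auto)
    from less.hyps[OF smaller[OF q] gr' this] obtain R where
      R: "\<forall>c\<in>set R. chain_data c"
        "\<And>z \<zeta>. tens (I - {q}) a' b' z \<zeta> = (\<Sum>(N, u, v)\<leftarrow>R. chain_tensor N u v z \<zeta>)" by blast
    then show ?thesis using c eq by (intro exI[of _ "(N, u, v) # R"]) (auto simp: add.commute)
  qed
qed

end

section \<open>Holomorphic functions and vector fields\<close>

text \<open>Entire functions, described by a complex-linear real derivative as in
  \<open>hol_on\<close>. The functions concerned are polynomials, so no domain is carried
  along.\<close>

definition chol :: "(complex^'n::finite \<Rightarrow> complex) \<Rightarrow> bool" where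
  "chol f \<longleftrightarrow> (\<forall>z. \<exists>D. (f has_derivative D) (at z) \<and> (\<forall>c v. D (c *s v) = c * D v))"

lemma chol_differentiable: "chol f \<Longrightarrow> f differentiable (at z)"
  unfolding chol_def differentiable_def by blast

lemma chol_has_derivative: "chol f \<Longrightarrow> (f has_derivative frechet_derivative f (at z)) (at z)"
  using chol_differentiable frechet_derivative_works by blast

lemma chol_scale_derivative:
  assumes "chol f"
  shows "frechet_derivative f (at z) (c *s v) = c * frechet_derivative f (at z) v"
  using assms frechet_derivative_at unfolding chol_def by metis

lemma chol_const: "chol (\<lambda>_. c)"
  unfolding chol_def by (intro allI exI[of _ "\<lambda>_. 0"]) (simp add: has_derivative_const)

lemma chol_nth: "chol (\<lambda>z. z $ i)"
  unfolding chol_def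
  by (intro allI exI[of _ "\<lambda>v. v $ i"])
    (auto intro!: bounded_linear_imp_has_derivative bounded_linear_vec_nth)

lemma has_derivative_add_chol:
  assumes "chol f" "chol g"
  shows "((\<lambda>z. f z + g z) has_derivative
    (\<lambda>v. frechet_derivative f (at z) v + frechet_derivative g (at z) v)) (at z)"
  by (intro has_derivative_add chol_has_derivative assms)

lemma has_derivative_mult_chol:
  assumes "chol f" "chol g"
  shows "((\<lambda>z. f z * g z) has_derivative
    (\<lambda>v. f z * frechet_derivative g (at z) v + frechet_derivative f (at z) v * g z)) (at z)"
  by (intro has_derivative_mult chol_has_derivative assms)

lemma chol_add: "chol f \<Longrightarrow> chol g \<Longrightarrow> chol (\<lambda>z. f z + g z)"
  unfolding chol_def[of "\<lambda>z. f z + g z"]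
  by (intro allI exI conjI, rule has_derivative_add_chol)
    (simp_all add: chol_scale_derivative algebra_simps)

lemma chol_mult: "chol f \<Longrightarrow> chol g \<Longrightarrow> chol (\<lambda>z. f z * g z)"
  unfolding chol_def[of "\<lambda>z. f z * g z"]
  by (intro allI exI conjI, rule has_derivative_mult_chol)
    (simp_all add: chol_scale_derivative algebra_simps)

text \<open>For holomorphic \<open>f\<close> this is \<Sum> F_j df/dz_j, by complex linearity of the
  derivative.\<close>

definition field_deriv ::
    "(complex^'n::finite \<Rightarrow> complex^'n) \<Rightarrow> (complex^'n \<Rightarrow> complex) \<Rightarrow> complex^'n \<Rightarrow> complex" where
  "field_deriv F f z = frechet_derivative f (at z) (F z)"

lemma field_deriv_add:
  "chol f \<Longrightarrow> chol g \<Longrightarrow> field_deriv F (\<lambda>z. f z + g z) = (\<lambda>z. field_deriv F f z + field_deriv F g z)"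
  unfolding field_deriv_def
  by (simp add: frechet_derivative_at[OF has_derivative_add_chol, symmetric])

lemma field_deriv_mult:
  "chol f \<Longrightarrow> chol g \<Longrightarrow>
    field_deriv F (\<lambda>z. f z * g z) = (\<lambda>z. f z * field_deriv F g z + field_deriv F f z * g z)"
  unfolding field_deriv_def
  by (simp add: frechet_derivative_at[OF has_derivative_mult_chol, symmetric])

lemma field_deriv_const: "field_deriv F (\<lambda>_. c) = (\<lambda>_. 0)"
  unfolding field_deriv_def by simp

lemma field_deriv_scale:
  "chol f \<Longrightarrow> field_deriv F (\<lambda>z. c * f z) = (\<lambda>z. c * field_deriv F f z)"
  using field_deriv_mult[OF chol_const, of f F c] by (simp add: field_deriv_const)

lemma field_deriv_nth: "field_deriv F (\<lambda>z. z $ i) = (\<lambda>z. F z $ i)"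
proof -
  have "((\<lambda>z. z $ i) has_derivative (\<lambda>v. v $ i)) (at z)" for z :: "complex^'a"
    by (intro bounded_linear_imp_has_derivative bounded_linear_vec_nth)
  from frechet_derivative_at[OF this, symmetric] show ?thesis
    unfolding field_deriv_def by simp
qed

section \<open>Wirtinger derivatives and the tangency equation\<close>

lemma linear_axis_expansion:
  fixes D :: "complex^'n::finite \<Rightarrow> 'b::real_vector"
  assumes "linear D"
  shows "D v = (\<Sum>j\<in>UNIV. Re (v $ j) *\<^sub>R D (axis j 1) + Im (v $ j) *\<^sub>R D (axis j \<i>))"
proof -
  have "v = (\<Sum>j\<in>UNIV. Re (v $ j) *\<^sub>R axis j 1 + Im (v $ j) *\<^sub>R axis j \<i>)"
    by (simp add: Finite_Cartesian_Product.vec_eq_iff axis_def complex_eq_iff if_distrib cong: if_cong)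
  then have "D v = D (\<Sum>j\<in>UNIV. Re (v $ j) *\<^sub>R axis j 1 + Im (v $ j) *\<^sub>R axis j \<i>)" by simp
  then show ?thesis by (simp add: linear_sum[OF assms] linear_add[OF assms] linear_scale[OF assms])
qed

lemma has_derivative_fst_chol:
  assumes "chol f"
  shows "((\<lambda>y. f (fst y)) has_derivative (\<lambda>h. frechet_derivative f (at (fst x)) (fst h))) (at x)"
  by (rule has_derivative_compose[OF has_derivative_fst[OF has_derivative_ident]])
    (rule chol_has_derivative[OF assms])

text \<open>By the Cauchy-Riemann equations the Wirtinger derivative in z_j is the ordinary
  derivative along \<open>axis j 1\<close>.\<close>

lemma apply_field_chol:
  assumes "chol f"
  shows "apply_field Y (\<lambda>y. f (fst y)) x = frechet_derivative f (at (fst x)) (fst (Y x))"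
proof -
  let ?D = "frechet_derivative f (at (fst x))"
  have lin: "linear ?D"
    using chol_has_derivative[OF assms] has_derivative_linear by blast
  have fr: "frechet_derivative (\<lambda>y. f (fst y)) (at x) = (\<lambda>h. ?D (fst h))"
    using frechet_derivative_at[OF has_derivative_fst_chol[OF assms]] by (rule sym)
  have ax: "?D (axis j \<i>) = \<i> * ?D (axis j 1)" for j
  proof -
    have "axis j \<i> = \<i> *s (axis j 1 :: complex^'a)"
      by (simp add: Finite_Cartesian_Product.vec_eq_iff axis_def)
    then show ?thesis using chol_scale_derivative[OF assms] by metis
  qed
  have "wirtinger_z j (\<lambda>y. f (fst y)) x = ?D (axis j 1)" for j
    unfolding wirtinger_z_def fr by (simp add: ax field_simps)
  moreover have "wirtinger_w (\<lambda>y. f (fst y)) x = 0"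
    unfolding wirtinger_w_def fr using linear_0[OF lin] by simp
  moreover have "?D (fst (Y x)) = (\<Sum>j\<in>UNIV. fst (Y x) $ j * ?D (axis j 1))"
    unfolding linear_axis_expansion[OF lin, of "fst (Y x)"]
    by (rule sum.cong) (simp_all add: ax complex_eq_iff)
  ultimately show ?thesis unfolding apply_field_def by simp
qed

text \<open>Re (F_j (\<rho>_x - i \<rho>_y)) = Re F_j \<rho>_x + Im F_j \<rho>_y, which adds up to
  the real derivative of \<rho> along \<open>Y x\<close>; the factor 1/2 is that of the Wirtinger
  derivatives.\<close>

lemma Re_apply_field_real:
  fixes \<rho> :: "(complex^'n::finite) \<times> complex \<Rightarrow> real"
  assumes "(\<rho> has_derivative D) (at x)"
  shows "Re (apply_field Y (\<lambda>x. complex_of_real (\<rho> x)) x) = D (Y x) / 2"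
proof -
  have lin: "linear D" using assms has_derivative_linear by blast
  have "((\<lambda>x. complex_of_real (\<rho> x)) has_derivative (\<lambda>v. complex_of_real (D v))) (at x)"
    by (rule has_derivative_of_real[OF assms])
  then have fr: "frechet_derivative (\<lambda>x. complex_of_real (\<rho> x)) (at x) = (\<lambda>v. complex_of_real (D v))"
    by (rule frechet_derivative_at[symmetric])
  have lin1: "linear (\<lambda>v. D (v, 0))" "linear (\<lambda>w. D (0, w))"
    using linear_compose[OF _ lin, of "\<lambda>v. (v, 0)"] linear_compose[OF _ lin, of "\<lambda>w. (0, w)"]
    by (auto simp: comp_def linear_iff)
  obtain F G where Y: "Y x = (F, G)" by fastforce
  have "D (Y x) = D (F, 0) + D (0, G)"
    using linear_add[OF lin, of "(F, 0)" "(0, G)"] Y by simp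
  also have "D (F, 0) = (\<Sum>j\<in>UNIV. Re (F $ j) * D (axis j 1, 0) + Im (F $ j) * D (axis j \<i>, 0))"
    using linear_axis_expansion[OF lin1(1), of F] by simp
  also have "D (0, G) = Re G * D (0, 1) + Im G * D (0, \<i>)"
  proof -
    have "D (0, G) = D (0, Re G *\<^sub>R 1 + Im G *\<^sub>R \<i>)"
      by (rule arg_cong[of _ _ "\<lambda>w. D (0, w)"]) (simp add: complex_eq_iff)
    then show ?thesis using linear_add[OF lin1(2)] linear_scale[OF lin1(2)] by simp
  qed
  finally show ?thesis
    unfolding apply_field_def wirtinger_z_def wirtinger_w_def fr Y
    by (simp add: sum_divide_distrib add_divide_distrib)
qed

text \<open>\<open>P\<close> does not involve w, so its derivative sees only the z-part of the
  field; tangency thus reads Im G = dP(F).\<close>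

lemma Re_apply_field_model:
  fixes P :: "complex^'n::finite \<Rightarrow> real"
  assumes "(P has_derivative D) (at z)"
  shows "Re (apply_field Y (model_defining P) (z, w)) =
    (Im (snd (Y (z, w))) - D (fst (Y (z, w)))) / 2"
proof -
  have "((\<lambda>x. Im (snd x) - P (fst x)) has_derivative (\<lambda>h. Im (snd h) - D (fst h))) (at (z, w))"
    by (intro has_derivative_diff has_derivative_Im has_derivative_snd has_derivative_ident
        has_derivative_compose[OF has_derivative_fst[OF has_derivative_ident], where g=P])
      (use assms in simp)
  from Re_apply_field_real[OF this, of Y] show ?thesis
    unfolding model_defining_def by (simp add: case_prod_unfold)
qed

section \<open>Weighted homogeneous polynomials\<close>

lemma whom_z_zero: "whom_z \<mu> \<kappa> (\<lambda>_. 0)"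
  unfolding whom_z_def by (intro exI[of _ "{}"]) simp

lemma whom_z_monom: "wdeg \<mu> \<alpha> = \<kappa> \<Longrightarrow> whom_z \<mu> \<kappa> (\<lambda>z. zmonom z \<alpha>)"
  unfolding whom_z_def by (intro exI[of _ "{\<alpha>}"] exI[of _ "\<lambda>_. 1"]) simp

lemma whom_z_scale:
  assumes "whom_z \<mu> \<kappa> f" shows "whom_z \<mu> \<kappa> (\<lambda>z. c * f z)"
proof -
  obtain S d where "finite S" "\<forall>\<alpha>\<in>S. wdeg \<mu> \<alpha> = \<kappa>" "f = (\<lambda>z. \<Sum>\<alpha>\<in>S. d \<alpha> * zmonom z \<alpha>)"
    using assms unfolding whom_z_def by blast
  then show ?thesis
    unfolding whom_z_def
    by (intro exI[of _ S] exI[of _ "\<lambda>\<alpha>. c * d \<alpha>"]) (simp add: sum_distrib_left mult.assoc)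
qed

lemma whom_z_add:
  assumes "whom_z \<mu> \<kappa> f" "whom_z \<mu> \<kappa> g" shows "whom_z \<mu> \<kappa> (\<lambda>z. f z + g z)"
proof -
  obtain S d where S: "finite S" "\<forall>\<alpha>\<in>S. wdeg \<mu> \<alpha> = \<kappa>" "f = (\<lambda>z. \<Sum>\<alpha>\<in>S. d \<alpha> * zmonom z \<alpha>)"
    using assms(1) unfolding whom_z_def by blast
  obtain T e where T: "finite T" "\<forall>\<alpha>\<in>T. wdeg \<mu> \<alpha> = \<kappa>" "g = (\<lambda>z. \<Sum>\<alpha>\<in>T. e \<alpha> * zmonom z \<alpha>)"
    using assms(2) unfolding whom_z_def by blast
  define h where "h \<alpha> = (if \<alpha> \<in> S then d \<alpha> else 0) + (if \<alpha> \<in> T then e \<alpha> else 0)" for \<alpha>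
  have "f z + g z = (\<Sum>\<alpha>\<in>S \<union> T. h \<alpha> * zmonom z \<alpha>)" for z
  proof -
    have "f z = (\<Sum>\<alpha>\<in>S \<union> T. (if \<alpha> \<in> S then d \<alpha> else 0) * zmonom z \<alpha>)"
      unfolding S(3) by (rule sum.mono_neutral_cong_left) (use S T in auto)
    moreover have "g z = (\<Sum>\<alpha>\<in>S \<union> T. (if \<alpha> \<in> T then e \<alpha> else 0) * zmonom z \<alpha>)"
      unfolding T(3) by (rule sum.mono_neutral_cong_left) (use S T in auto)
    ultimately show ?thesis by (simp add: h_def distrib_right sum.distrib)
  qed
  then show ?thesis
    unfolding whom_z_def using S T by (intro exI[of _ "S \<union> T"] exI[of _ h]) auto
qed

lemma whom_z_induct [consumes 1, case_names zero monom add scale]: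
  assumes "whom_z \<mu> \<kappa> f"
    and zero: "Q (\<lambda>_. 0)"
    and monom: "\<And>\<alpha>. wdeg \<mu> \<alpha> = \<kappa> \<Longrightarrow> Q (\<lambda>z. zmonom z \<alpha>)"
    and add: "\<And>f g. Q f \<Longrightarrow> Q g \<Longrightarrow> Q (\<lambda>z. f z + g z)"
    and scale: "\<And>c f. Q f \<Longrightarrow> Q (\<lambda>z. c * f z)"
  shows "Q f"
proof -
  obtain S d where S: "finite S" "\<forall>\<alpha>\<in>S. wdeg \<mu> \<alpha> = \<kappa>" "f = (\<lambda>z. \<Sum>\<alpha>\<in>S. d \<alpha> * zmonom z \<alpha>)"
    using assms(1) unfolding whom_z_def by blast
  have "Q (\<lambda>z. \<Sum>\<alpha>\<in>S. d \<alpha> * zmonom z \<alpha>)"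
    using S(1,2) by (induction S rule: finite_induct) (simp_all add: zero monom add scale)
  then show ?thesis using S(3) by simp
qed

lemma whom_z_mult:
  assumes "whom_z \<mu> \<kappa> f" "whom_z \<mu> \<eta> g"
  shows "whom_z \<mu> (\<kappa> + \<eta>) (\<lambda>z. f z * g z)"
  using assms(1)
proof (induction rule: whom_z_induct)
  case (monom \<alpha>)
  show ?case using assms(2)
  proof (induction rule: whom_z_induct)
    case (monom \<beta>)
    have "zmonom z \<alpha> * zmonom z \<beta> = zmonom z (\<lambda>i. \<alpha> i + \<beta> i)" for z
      unfolding zmonom_def by (simp add: power_add prod.distrib)
    then show ?case
      using whom_z_monom[of \<mu> "\<lambda>i. \<alpha> i + \<beta> i" "\<kappa> + \<eta>"] monom \<open>wdeg \<mu> \<alpha> = \<kappa>\<close>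
      unfolding wdeg_def by (simp add: distrib_right sum.distrib)
  next
    case (add f g)
    then show ?case using whom_z_add by (simp add: distrib_left)
  next
    case (scale c f)
    then show ?case using whom_z_scale[of _ _ _ c] by (simp add: mult.left_commute)
  qed (simp add: whom_z_zero)
next
  case (add f g)
  then show ?case using whom_z_add by (simp add: distrib_right)
next
  case (scale c f)
  then show ?case using whom_z_scale[of _ _ _ c] by (simp add: mult.assoc)
qed (simp add: whom_z_zero)

lemma whom_z_one: "whom_z \<mu> 0 (\<lambda>_. 1)"
  using whom_z_monom[of \<mu> "\<lambda>_. 0" 0] unfolding wdeg_def zmonom_def by simp

lemma whom_z_nth: "whom_z \<mu> (\<mu> i) (\<lambda>z. z $ i)"
proof -
  have "wdeg \<mu> (\<lambda>j. if j = i then 1 else 0) = \<mu> i"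
    unfolding wdeg_def by (simp add: if_distrib if_distribR cong: if_cong)
  moreover have "zmonom z (\<lambda>j. if j = i then 1 else 0) = z $ i" for z :: "complex^'a"
    unfolding zmonom_def by (simp add: if_distrib cong: if_cong)
  ultimately show ?thesis using whom_z_monom[of \<mu> "\<lambda>j. if j = i then 1 else 0"] by simp
qed

text \<open>A monomial is built from 1, coordinates and products. The weight is an argument of
  \<open>Q\<close> because it changes with every product.\<close>

lemma zmonom_induct:
  assumes one: "Q 0 (\<lambda>_. 1)" and nth: "\<And>i. Q (\<mu> i) (\<lambda>z. z $ i)"
    and mult: "\<And>\<kappa> \<eta> f g. Q \<kappa> f \<Longrightarrow> Q \<eta> g \<Longrightarrow> Q (\<kappa> + \<eta>) (\<lambda>z. f z * g z)"
  shows "Q (wdeg \<mu> \<alpha>) (\<lambda>z. zmonom z \<alpha>)"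
proof -
  have pow: "Q (of_nat k * \<mu> i) (\<lambda>z. (z $ i) ^ k)" for k i
  proof (induction k)
    case (Suc k)
    from mult[OF nth this, of i] show ?case by (simp add: distrib_right)
  qed (simp add: one)
  have "Q (\<Sum>i\<in>J. of_nat (\<alpha> i) * \<mu> i) (\<lambda>z. \<Prod>i\<in>J. (z $ i) ^ \<alpha> i)" if "finite J" for J
    using that by (induction J rule: finite_induct) (simp_all add: one mult pow)
  from this[of UNIV] show ?thesis unfolding wdeg_def zmonom_def by simp
qed

lemma chol_whom_z:
  assumes "whom_z \<mu> \<kappa> f" shows "chol f"
  using assms
proof (induction rule: whom_z_induct)
  case (monom \<alpha>)
  show ?case by (rule zmonom_induct[of "\<lambda>_. chol" \<mu>]) (simp_all add: chol_const chol_nth chol_mult)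
qed (simp_all add: chol_const chol_add chol_mult)

lemma whom_z_field_deriv:
  assumes F: "\<And>j. whom_z \<mu> (\<nu> + \<mu> j) (\<lambda>z. F z $ j)" and f: "whom_z \<mu> \<kappa> f"
  shows "whom_z \<mu> (\<kappa> + \<nu>) (field_deriv F f)"
proof -
  \<comment> \<open>The Leibniz rule needs the weight and the differentiability of the
    undifferentiated factors, so they are part of the induction statement.\<close>
  define Q where "Q \<kappa> f \<longleftrightarrow> whom_z \<mu> \<kappa> f \<and> chol f \<and> whom_z \<mu> (\<kappa> + \<nu>) (field_deriv F f)" for \<kappa> f
  have "Q \<kappa> f" using f
  proof (induction rule: whom_z_induct)
    case zero
    then show ?case by (simp add: Q_def whom_z_zero chol_const field_deriv_const)
  next
    case (monom \<alpha>)
    have "Q (wdeg \<mu> \<alpha>) (\<lambda>z. zmonom z \<alpha>)"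
    proof (rule zmonom_induct)
      show "Q 0 (\<lambda>_. 1)" by (simp add: Q_def whom_z_one whom_z_zero chol_const field_deriv_const)
      show "Q (\<mu> i) (\<lambda>z. z $ i)" for i
        using F[of i] by (simp add: Q_def whom_z_nth chol_nth field_deriv_nth add.commute)
      show "Q (\<kappa> + \<eta>) (\<lambda>z. f z * g z)" if Q: "Q \<kappa> f" "Q \<eta> g" for \<kappa> \<eta> f g
      proof -
        have "whom_z \<mu> (\<kappa> + (\<eta> + \<nu>)) (\<lambda>z. f z * field_deriv F g z)"
          "whom_z \<mu> ((\<kappa> + \<nu>) + \<eta>) (\<lambda>z. field_deriv F f z * g z)"
          using Q whom_z_mult unfolding Q_def by blast+
        then have "whom_z \<mu> (\<kappa> + \<eta> + \<nu>) (\<lambda>z. f z * field_deriv F g z + field_deriv F f z * g z)"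
          using whom_z_add by (simp add: add_ac)
        then show ?thesis using Q unfolding Q_def
          by (simp add: whom_z_mult chol_mult field_deriv_mult)
      qed
    qed
    then show ?case using monom by simp
  next
    case (add f g)
    then show ?case by (simp add: Q_def whom_z_add chol_add field_deriv_add)
  next
    case (scale c f)
    then show ?case by (simp add: Q_def whom_z_scale chol_mult chol_const field_deriv_scale)
  qed
  then show ?thesis unfolding Q_def by blast
qed

text \<open>Real powers are taken because the weights are rational; the scaling law below therefore
  asks for \<open>0 < t\<close>.\<close>

definition dilation :: "('n::finite \<Rightarrow> rat) \<Rightarrow> real \<Rightarrow> complex^'n \<Rightarrow> complex^'n" where
  "dilation \<mu> t z = (\<chi> i. complex_of_real (t powr of_rat (\<mu> i)) * z $ i)"

lemma whom_z_dilation: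
  assumes "whom_z \<mu> \<kappa> f" "0 < t"
  shows "f (dilation \<mu> t z) = complex_of_real (t powr of_rat \<kappa>) * f z"
  using assms(1)
proof (induction rule: whom_z_induct)
  case (monom \<alpha>)
  have "zmonom (dilation \<mu> t z) \<alpha> = complex_of_real (t powr of_rat (wdeg \<mu> \<alpha>)) * zmonom z \<alpha>"
    by (rule zmonom_induct[where Q="\<lambda>\<kappa> f. f (dilation \<mu> t z) = complex_of_real (t powr of_rat \<kappa>) * f z"])
      (use assms(2) in \<open>simp_all add: dilation_def of_rat_add powr_add\<close>)
  then show ?case using monom by simp
qed (simp_all add: distrib_left)

text \<open>Evaluation at the dilations by 2^n gives \<Sum> x_k^n h_k(z) = 0 for all n, with
  pairwise distinct x_k = 2^k: a Vandermonde system.\<close>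

lemma whom_z_separate:
  assumes K: "finite K" and H: "\<And>k. k \<in> K \<Longrightarrow> whom_z \<mu> k (h k)"
    and sum0: "\<And>z. (\<Sum>k\<in>K. h k z) = 0" and k: "k \<in> K"
  shows "h k z = 0"
proof -
  define x where "x k = complex_of_real (2 powr of_rat k)" for k
  have "inj x" unfolding x_def inj_on_def by (simp add: powr_inj)
  have pow: "(\<Sum>k\<in>K. x k ^ n * h k z) = 0" for n
  proof -
    have "(2 ^ n) powr of_rat k = (2 powr of_rat k :: real) ^ n" for k
      by (simp add: powr_realpow[symmetric] powr_powr mult.commute)
    then have "h k (dilation \<mu> (2 ^ n) z) = x k ^ n * h k z" if "k \<in> K" for k
      using whom_z_dilation[OF H[OF that], of "2 ^ n" z] unfolding x_def by simp
    then show ?thesis using sum0[of "dilation \<mu> (2 ^ n) z"] by simp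
  qed
  \<comment> \<open>Weighting the n-th equation with the n-th coefficient of this Lagrange
    polynomial, which vanishes at all nodes but \<open>x k\<close>, isolates
    \<open>h k z\<close>.\<close>
  define p where "p = (\<Prod>l\<in>K - {k}. [:- x l, 1:])"
  have "0 = (\<Sum>n\<le>degree p. coeff p n * (\<Sum>k\<in>K. x k ^ n * h k z))" by (simp add: pow)
  also have "\<dots> = (\<Sum>l\<in>K. poly p (x l) * h l z)"
    unfolding poly_altdef sum_distrib_left sum_distrib_right
    by (subst sum.swap) (simp add: mult.assoc)
  also have "\<dots> = (\<Sum>l\<in>K. if l = k then poly p (x k) * h k z else 0)"
    by (rule sum.cong) (use K in \<open>auto simp: p_def poly_prod\<close>)
  also have "\<dots> = poly p (x k) * h k z" using K k by simp
  finally have "poly p (x k) * h k z = 0" by simp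
  moreover have "poly p (x k) \<noteq> 0"
    using K \<open>inj x\<close> unfolding p_def poly_prod by (auto simp: inj_eq)
  ultimately show ?thesis by simp
qed

lemma whom_z_at_zero:
  assumes "whom_z \<mu> \<kappa> f" "\<kappa> \<noteq> 0"
  shows "f 0 = 0"
proof -
  have "dilation \<mu> 2 0 = 0" unfolding dilation_def by (simp add: Finite_Cartesian_Product.vec_eq_iff)
  then have "f 0 = complex_of_real (2 powr of_rat \<kappa>) * f 0"
    using whom_z_dilation[OF assms(1), of 2 0] by simp
  moreover have "complex_of_real (2 powr of_rat \<kappa>) \<noteq> 1" using assms(2) by simp
  ultimately show ?thesis by (metis mult_cancel_right1)
qed

section \<open>Polarization\<close>

text \<open>Satisfied by polynomials in z and cnj \<open>\<zeta>\<close>: conjugating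
  \<open>\<zeta>\<close> turns cnj t into t, so along such a line K is a polynomial in t alone. Real
  t give points of the diagonal when p and q are used for both arguments.\<close>

definition line_poly :: "(complex^'n::finite \<Rightarrow> complex^'n \<Rightarrow> complex) \<Rightarrow> bool" where
  "line_poly K \<longleftrightarrow> (\<forall>p q. \<exists>r. \<forall>t. K (p + t *s q) (p + cnj t *s q) = poly r t)"

lemma line_poly_const: "line_poly (\<lambda>z \<zeta>. c)"
  unfolding line_poly_def by (intro allI exI[of _ "[:c:]"]) simp

lemma line_poly_add:
  assumes "line_poly K" "line_poly L" shows "line_poly (\<lambda>z \<zeta>. K z \<zeta> + L z \<zeta>)"
  unfolding line_poly_def
proof (intro allI)
  fix p q
  obtain r s where "\<And>t. K (p + t *s q) (p + cnj t *s q) = poly r t"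
    "\<And>t. L (p + t *s q) (p + cnj t *s q) = poly s t"
    using assms unfolding line_poly_def by blast
  then show "\<exists>r. \<forall>t. K (p + t *s q) (p + cnj t *s q) + L (p + t *s q) (p + cnj t *s q) = poly r t"
    by (intro exI[of _ "r + s"]) simp
qed

lemma line_poly_mult:
  assumes "line_poly K" "line_poly L" shows "line_poly (\<lambda>z \<zeta>. K z \<zeta> * L z \<zeta>)"
  unfolding line_poly_def
proof (intro allI)
  fix p q
  obtain r s where "\<And>t. K (p + t *s q) (p + cnj t *s q) = poly r t"
    "\<And>t. L (p + t *s q) (p + cnj t *s q) = poly s t"
    using assms unfolding line_poly_def by blast
  then show "\<exists>r. \<forall>t. K (p + t *s q) (p + cnj t *s q) * L (p + t *s q) (p + cnj t *s q) = poly r t"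
    by (intro exI[of _ "r * s"]) simp
qed

lemma line_poly_sum:
  "finite I \<Longrightarrow> (\<And>i. i \<in> I \<Longrightarrow> line_poly (K i)) \<Longrightarrow> line_poly (\<lambda>z \<zeta>. \<Sum>i\<in>I. K i z \<zeta>)"
  by (induction I rule: finite_induct) (simp_all add: line_poly_const line_poly_add)

lemma line_poly_left:
  assumes "whom_z \<mu> \<kappa> f" shows "line_poly (\<lambda>z \<zeta>. f z)"
  using assms
proof (induction rule: whom_z_induct)
  case (monom \<alpha>)
  have nth: "line_poly (\<lambda>z \<zeta>. z $ i)" for i :: 'a
    unfolding line_poly_def
    by (intro allI, rule_tac x="[:p $ i, q $ i:]" in exI) simp
  show ?case
    by (rule zmonom_induct[where Q="\<lambda>_ f. line_poly (\<lambda>z \<zeta>. f z)" and \<mu>=\<mu>])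
      (simp_all add: line_poly_const nth line_poly_mult)
qed (simp_all add: line_poly_const line_poly_add line_poly_mult)

lemma line_poly_right:
  assumes "whom_z \<mu> \<kappa> f" shows "line_poly (\<lambda>z \<zeta>. cnj (f \<zeta>))"
  using assms
proof (induction rule: whom_z_induct)
  case (monom \<alpha>)
  have nth: "line_poly (\<lambda>z \<zeta>. cnj (\<zeta> $ i))" for i :: 'a
    unfolding line_poly_def
    by (intro allI, rule_tac x="[:cnj (p $ i), cnj (q $ i):]" in exI) simp
  show ?case
    by (rule zmonom_induct[where Q="\<lambda>_ f. line_poly (\<lambda>z \<zeta>. cnj (f \<zeta>))" and \<mu>=\<mu>])
      (simp_all add: line_poly_const nth line_poly_mult)
qed (simp_all add: line_poly_const line_poly_add line_poly_mult)

lemma poly_zero_of_reals: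
  fixes r :: "complex poly"
  assumes "infinite A" "\<And>s. s \<in> A \<Longrightarrow> poly r (complex_of_real s) = 0"
  shows "r = 0"
proof -
  have "infinite (complex_of_real ` A)"
    using assms(1) finite_image_iff[of complex_of_real A] by (simp add: inj_on_def)
  moreover have "complex_of_real ` A \<subseteq> {x. poly r x = 0}" using assms(2) by auto
  ultimately have "infinite {x. poly r x = 0}" using finite_subset by blast
  then show ?thesis using poly_roots_finite by blast
qed

text \<open>A polynomial in t vanishing on infinitely many reals is zero. This is used twice: along
  real rays, to pass from a neighbourhood of 0 to the whole diagonal, and along a line through the
  diagonal, to leave it.\<close>

lemma polarization:
  fixes K :: "complex^'n::finite \<Rightarrow> complex^'n \<Rightarrow> complex"
  assumes K: "line_poly K" and ev: "\<forall>\<^sub>F z in nhds 0. K z z = 0"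
  shows "K z \<zeta> = 0"
proof -
  have diag: "K z z = 0" for z
  proof -
    obtain r where r: "\<And>t. K (t *s z) (cnj t *s z) = poly r t"
      using K[unfolded line_poly_def, rule_format, of 0 z] by auto
    have "((\<lambda>s. complex_of_real s *s z) \<longlongrightarrow> 0) (at_right 0)"
    proof -
      have "(\<lambda>s. complex_of_real s *s z) = (\<lambda>s. s *\<^sub>R z)"
        by (intro ext) (simp add: Finite_Cartesian_Product.vec_eq_iff complex_eq_iff)
      moreover have "((\<lambda>s. s *\<^sub>R z) \<longlongrightarrow> 0 *\<^sub>R z) (at_right 0)" by (intro tendsto_intros)
      ultimately show ?thesis by simp
    qed
    from eventually_compose_filterlim[OF ev this]
    have "\<forall>\<^sub>F s in at_right 0. K (complex_of_real s *s z) (complex_of_real s *s z) = 0" .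
    then obtain b where b: "0 < b" "\<And>s. 0 < s \<Longrightarrow> s < b \<Longrightarrow> poly r (complex_of_real s) = 0"
      unfolding eventually_at_right_field using r[of "complex_of_real _"] by auto
    have "r = 0"
      by (rule poly_zero_of_reals[of "{0<..<b}"]) (use b in \<open>auto simp: infinite_Ioo\<close>)
    then show ?thesis using r[of 1] by simp
  qed
  \<comment> \<open>Chosen so that t = i leads to the pair (z, \<open>\<zeta>\<close>): p + i q = z
    and p - i q = \<open>\<zeta>\<close>.\<close>
  define p where "p = (1 / 2) *s (z + \<zeta>)"
  define q where "q = (1 / (2 * \<i>)) *s (z - \<zeta>)"
  obtain r where r: "\<And>t. K (p + t *s q) (p + cnj t *s q) = poly r t"
    using K unfolding line_poly_def by blast
  have "r = 0"
    by (rule poly_zero_of_reals[of UNIV]) (use diag in \<open>auto simp: infinite_UNIV_char_0 r[symmetric]\<close>)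
  moreover have "p + \<i> *s q = z" "p + cnj \<i> *s q = \<zeta>"
    unfolding p_def q_def by (simp_all add: Finite_Cartesian_Product.vec_eq_iff field_simps)
  ultimately show ?thesis using r[of \<i>] by simp
qed

section \<open>Chains from invariant tensors\<close>

lemma graded_operator_field_deriv:
  assumes "0 < \<nu>" "\<And>j. whom_z \<mu> (\<nu> + \<mu> j) (\<lambda>z. F z $ j)"
  shows "graded_operator (whom_z \<mu>) chol (field_deriv F) \<nu>"
proof
  show "h k z = 0" if "finite K" "\<And>k. k \<in> K \<Longrightarrow> whom_z \<mu> k (h k)" "\<And>z. (\<Sum>k\<in>K. h k z) = 0"
    "k \<in> K" for K h k and z :: "complex^'a"
    using whom_z_separate[OF that] .
qed (simp_all add: assms whom_z_zero whom_z_add whom_z_scale whom_z_field_deriv chol_whom_z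
    chol_add chol_mult chol_const field_deriv_add field_deriv_scale)

lemma has_derivative_hermitian:
  assumes "chol f" "chol g"
  shows "((\<lambda>z. f z * cnj (g z)) has_derivative
    (\<lambda>v. f z * cnj (frechet_derivative g (at z) v) + frechet_derivative f (at z) v * cnj (g z))) (at z)"
  by (intro has_derivative_mult has_derivative_cnj chol_has_derivative assms)

text \<open>On the diagonal z moves in both slots, so the derivative along F is the sum of the two
  halves of the invariance condition.\<close>

lemma has_derivative_tens_diag:
  assumes "\<And>i. i \<in> I \<Longrightarrow> chol (a i)" "\<And>i. i \<in> I \<Longrightarrow> chol (b i)"
  shows "\<exists>D. ((\<lambda>z. tens I a b z z) has_derivative D) (at z) \<and>
    D (F z) = tens I (\<lambda>i. field_deriv F (a i)) b z z + tens I a (\<lambda>i. field_deriv F (b i)) z z"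
proof (intro exI conjI)
  show "((\<lambda>z. tens I a b z z) has_derivative (\<lambda>v. \<Sum>i\<in>I.
      a i z * cnj (frechet_derivative (b i) (at z) v) + frechet_derivative (a i) (at z) v * cnj (b i z))) (at z)"
    unfolding tens_def by (intro has_derivative_sum has_derivative_hermitian assms)
qed (simp add: tens_def field_deriv_def sum.distrib)

lemma line_poly_tens:
  assumes "finite I" "\<And>i. i \<in> I \<Longrightarrow> \<exists>\<kappa>. whom_z \<mu> \<kappa> (a i)" "\<And>i. i \<in> I \<Longrightarrow> \<exists>\<kappa>. whom_z \<mu> \<kappa> (b i)"
  shows "line_poly (tens I a b)"
proof -
  have "line_poly (\<lambda>z \<zeta>. a i z * cnj (b i \<zeta>))" if "i \<in> I" for i
    using assms(2,3)[OF that] line_poly_mult line_poly_left line_poly_right by blast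
  then have "line_poly (\<lambda>z \<zeta>. \<Sum>i\<in>I. a i z * cnj (b i \<zeta>))"
    by (rule line_poly_sum[OF assms(1)])
  then show ?thesis unfolding tens_def[abs_def] .
qed

section \<open>Invariance of the polarized model polynomial\<close>

lemma whom_zw_slice:
  assumes "whom_zw \<mu> \<kappa> f" shows "whom_z \<mu> \<kappa> (\<lambda>z. f (z, 0))"
proof -
  obtain S c where S: "finite S" "\<forall>(\<alpha>, l)\<in>S. wdeg \<mu> \<alpha> + of_nat l = \<kappa>"
    "f = (\<lambda>(z, w). \<Sum>(\<alpha>, l)\<in>S. c \<alpha> l * zmonom z \<alpha> * w ^ l)"
    using assms unfolding whom_zw_def by blast
  define S0 where "S0 = {\<alpha>. (\<alpha>, 0::nat) \<in> S}"
  have img: "(\<lambda>\<alpha>. (\<alpha>, 0)) ` S0 \<subseteq> S" unfolding S0_def by auto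
  have "f (z, 0) = (\<Sum>x\<in>(\<lambda>\<alpha>. (\<alpha>, 0::nat)) ` S0. case x of (\<alpha>, l) \<Rightarrow> c \<alpha> l * zmonom z \<alpha> * 0 ^ l)" for z
    unfolding S(3) prod.case
    by (rule sum.mono_neutral_right) (use S(1) img in \<open>auto simp: S0_def image_iff\<close>)
  then have "f (z, 0) = (\<Sum>\<alpha>\<in>S0. c \<alpha> 0 * zmonom z \<alpha>)" for z
    by (simp add: sum.reindex inj_on_def)
  moreover have "finite S0"
    using finite_imageD[OF finite_subset[OF img S(1)]] by (simp add: inj_on_def)
  moreover have "\<forall>\<alpha>\<in>S0. wdeg \<mu> \<alpha> = \<kappa>" using S(2) unfolding S0_def by auto
  ultimately show ?thesis
    unfolding whom_z_def by (intro exI[of _ S0] exI[of _ "\<lambda>\<alpha>. c \<alpha> 0"]) auto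
qed

lemma whom_field_slice:
  assumes "whom_field \<mu> \<nu> Y"
  shows "whom_z \<mu> (\<nu> + \<mu> j) (\<lambda>z. fst (Y (z, 0)) $ j)" "whom_z \<mu> (\<nu> + 1) (\<lambda>z. snd (Y (z, 0)))"
  using assms whom_zw_slice unfolding whom_field_def by blast+

lemma zzbar_poly_tens:
  assumes "zzbar_poly E f"
  shows "\<exists>S a b. finite S \<and> S \<subseteq> E \<and> (\<forall>z. f z = tens S a b z z) \<and>
    (\<forall>i\<in>S. whom_z \<mu> (wdeg \<mu> (fst i)) (a i) \<and> b i = (\<lambda>z. zmonom z (snd i)))"
proof -
  obtain S c where S: "finite S" "S \<subseteq> E"
    "f = (\<lambda>z. \<Sum>(\<alpha>, \<beta>)\<in>S. c \<alpha> \<beta> * zmonom z \<alpha> * cnj (zmonom z \<beta>))"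
    using assms unfolding zzbar_poly_def by blast
  show ?thesis
    by (intro exI[of _ S] exI[of _ "\<lambda>i z. c (fst i) (snd i) * zmonom z (fst i)"]
        exI[of _ "\<lambda>i z. zmonom z (snd i)"])
      (simp add: S tens_def case_prod_unfold whom_z_scale whom_z_monom)
qed

lemma zmonom_zero: "\<alpha> \<noteq> (\<lambda>_. 0) \<Longrightarrow> zmonom 0 \<alpha> = 0"
  unfolding zmonom_def by (auto simp: fun_eq_iff)

text \<open>The given presentation may differ from the one without pluriharmonic terms. Both agree
  on the diagonal, hence everywhere by polarization, and in the latter each summand has a
  nonconstant second factor, which vanishes at 0.\<close>

lemma tens_no_pluriharmonic:
  assumes "no_pluriharmonic_terms f"
    and "finite I" "\<And>i. i \<in> I \<Longrightarrow> \<exists>\<kappa>. whom_z \<mu> \<kappa> (a i)" "\<And>i. i \<in> I \<Longrightarrow> \<exists>\<kappa>. whom_z \<mu> \<kappa> (b i)"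
    and f: "\<And>z. f z = tens I a b z z"
  shows "tens I a b z 0 = 0"
proof -
  obtain S a' b' where S: "finite S" "S \<subseteq> {(\<alpha>, \<beta>). \<alpha> \<noteq> (\<lambda>_. 0) \<and> \<beta> \<noteq> (\<lambda>_. 0)}"
    "\<And>z. f z = tens S a' b' z z"
    "\<And>i. i \<in> S \<Longrightarrow> whom_z \<mu> (wdeg \<mu> (fst i)) (a' i) \<and> b' i = (\<lambda>z. zmonom z (snd i))"
    using zzbar_poly_tens[OF assms(1)[unfolded no_pluriharmonic_terms_def], of \<mu>] by blast
  have b': "\<exists>\<kappa>. whom_z \<mu> \<kappa> (b' i)" if "i \<in> S" for i
    using S(4)[OF that] whom_z_monom[OF refl, of \<mu> "snd i"] by auto
  have lp: "line_poly (tens S a' b')"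
    by (rule line_poly_tens[where \<mu>=\<mu>]) (use S(1,4) b' in blast)+
  have "line_poly (\<lambda>z \<zeta>. tens I a b z \<zeta> + (-1) * tens S a' b' z \<zeta>)"
    by (intro line_poly_add line_poly_mult line_poly_const lp line_poly_tens[where \<mu>=\<mu> and I=I] assms)
  from polarization[OF this, of z 0] have "tens I a b z 0 = tens S a' b' z 0"
    using f S(3) by simp
  also have "\<dots> = 0"
    unfolding tens_def
  proof (rule sum.neutral, intro ballI)
    fix i assume i: "i \<in> S"
    then have "snd i \<noteq> (\<lambda>_. 0)" using S(2) by auto
    from zmonom_zero[OF this] show "a' i z * cnj (b' i 0) = 0" using S(4)[OF i] by simp
  qed
  finally show ?thesis .
qed

lemma whom_field_at_zero:
  assumes "0 < \<nu>" "\<And>j. 0 < \<mu> j" "\<And>j. whom_z \<mu> (\<nu> + \<mu> j) (\<lambda>z. F z $ j)"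
  shows "F 0 = (0 :: complex^'n::finite)"
proof -
  have "F 0 $ j = 0" for j
    using whom_z_at_zero[OF assms(3)] assms(1,2) by (metis add_pos_pos less_irrefl)
  then show ?thesis by (simp add: Finite_Cartesian_Product.vec_eq_iff)
qed

text \<open>The coefficient \<open>G\<close> of \<open>\<partial>/\<partial>w\<close> contributes only pluriharmonic terms to the tangency equation,
  so it vanishes and the equation polarizes to the invariance of the polarized \<open>P\<close>.\<close>

lemma aut_field_invariant_tensor:
  fixes P :: "complex^'n::finite \<Rightarrow> real" and Y :: "'n vfield"
  assumes Y: "Y \<in> aut_fields P" "rigid_field Y" "whom_field \<mu> \<nu> Y" "0 < \<nu>"
    and \<mu>: "\<And>j. 0 < \<mu> j"
    and gr: "graded_operator.graded_family (whom_z \<mu>) 1 I \<kappa> a b"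
    and P: "\<And>z. complex_of_real (P z) = tens I a b z z"
    and np: "no_pluriharmonic_terms (\<lambda>z. complex_of_real (P z))"
  shows "graded_operator.invariant_tensor (field_deriv (\<lambda>z. fst (Y (z, 0)))) (tens I a b)"
proof -
  define F where "F z = fst (Y (z, 0))" for z
  define G where "G z = snd (Y (z, 0))" for z
  have F: "whom_z \<mu> (\<nu> + \<mu> j) (\<lambda>z. F z $ j)" for j
    unfolding F_def by (rule whom_field_slice[OF Y(3)])
  have G: "whom_z \<mu> (\<nu> + 1) G"
    unfolding G_def[abs_def] by (rule whom_field_slice[OF Y(3)])
  interpret graded_operator "whom_z \<mu>" chol "field_deriv F" \<nu>
    by (rule graded_operator_field_deriv[OF Y(4) F])
  have rigid: "Y (z, w) = (F z, G z)" for z w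
    using Y(2) unfolding rigid_field_def F_def G_def by (metis prod.collapse)
  have fin: "finite I" and H: "\<And>i. i \<in> I \<Longrightarrow> whom_z \<mu> (\<kappa> i) (a i)"
    "\<And>i. i \<in> I \<Longrightarrow> whom_z \<mu> (1 - \<kappa> i) (b i)"
    using gr unfolding graded_family_def by blast+
  have W: "\<And>i. i \<in> I \<Longrightarrow> chol (a i)" "\<And>i. i \<in> I \<Longrightarrow> chol (b i)"
    using H chol_whom_z by blast+
  let ?K = "\<lambda>z \<zeta>. tens I (\<lambda>i. field_deriv F (a i)) b z \<zeta> + tens I a (\<lambda>i. field_deriv F (b i)) z \<zeta>"
  have slice0: "tens I a b z 0 = 0" for z
    by (rule tens_no_pluriharmonic[OF np fin _ _ P]) (use H in blast)+
  have deriv: "\<exists>D. (P has_derivative D) (at z) \<and> complex_of_real (D (F z)) = ?K z z" for z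
  proof -
    obtain D where D: "((\<lambda>z. tens I a b z z) has_derivative D) (at z)" "D (F z) = ?K z z"
      using has_derivative_tens_diag[of I a b z F] W by blast
    have "P = (\<lambda>z. Re (tens I a b z z))" using P by (metis Re_complex_of_real)
    then have D': "(P has_derivative (\<lambda>v. Re (D v))) (at z)"
      using has_derivative_Re[OF D(1)] by simp
    \<comment> \<open>The complex derivative of the tensor is real because the function is;
      uniqueness of derivatives turns the real identity for P into one for
      \<open>?K\<close>.\<close>
    have "((\<lambda>z. complex_of_real (P z)) has_derivative (\<lambda>v. complex_of_real (Re (D v)))) (at z)"
      by (rule has_derivative_of_real[OF D'])
    then have "((\<lambda>z. tens I a b z z) has_derivative (\<lambda>v. complex_of_real (Re (D v)))) (at z)"
      unfolding P .
    then have "(\<lambda>v. complex_of_real (Re (D v))) = D"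
      using has_derivative_unique D(1) by blast
    then have "complex_of_real (Re (D (F z))) = D (F z)" by (rule fun_cong)
    then show ?thesis using D' D(2) by metis
  qed
  have "P 0 = 0" using P[of 0] slice0[of 0] by simp
  obtain S where S: "open S" "0 \<in> S"
    "\<And>x. x \<in> S \<inter> model_hypersurface P \<Longrightarrow> Re (apply_field Y (model_defining P) x) = 0"
    using Y(1) unfolding aut_fields_def by blast
  have "isCont P 0" using deriv[of 0] has_derivative_continuous by blast
  \<comment> \<open>The point of the model above z with Re w = 0. The field is rigid, so one point
    above each z is enough; continuity and \<open>P 0 = 0\<close> keep it in \<open>S\<close> for
    small z.\<close>
  define g where "g z = (z, \<i> * complex_of_real (P z))" for z
  have "isCont g 0"
    unfolding g_def[abs_def] by (intro continuous_intros \<open>isCont P 0\<close>)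
  then have "(g \<longlongrightarrow> g 0) (nhds 0)"
    unfolding isCont_def tendsto_at_iff_tendsto_nhds .
  moreover have "g 0 \<in> S" using S(2) \<open>P 0 = 0\<close> unfolding g_def by (simp add: zero_prod_def)
  ultimately have "\<forall>\<^sub>F z in nhds 0. (z, \<i> * complex_of_real (P z)) \<in> S"
    using S(1) topological_tendstoD unfolding g_def[abs_def] by blast
  \<comment> \<open>The last term is - Im G, written through G and its conjugate so that it
    polarizes.\<close>
  then have "\<forall>\<^sub>F z in nhds 0. ?K z z + (-1 / (2 * \<i>)) * (G z + (-1) * cnj (G z)) = 0"
  proof (rule eventually_mono)
    fix z assume z: "(z, \<i> * complex_of_real (P z)) \<in> S"
    obtain D where D: "(P has_derivative D) (at z)" "complex_of_real (D (F z)) = ?K z z"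
      using deriv by blast
    have "(z, \<i> * complex_of_real (P z)) \<in> model_hypersurface P"
      unfolding model_hypersurface_def by simp
    then have "Re (apply_field Y (model_defining P) (z, \<i> * complex_of_real (P z))) = 0"
      using S(3) z by blast
    then have "Im (G z) = D (F z)"
      unfolding Re_apply_field_model[OF D(1)] rigid by simp
    then have "?K z z = complex_of_real (Im (G z))" using D(2) by simp
    then show "?K z z + (-1 / (2 * \<i>)) * (G z + (-1) * cnj (G z)) = 0"
      by (simp add: complex_eq_iff)
  qed
  moreover have "line_poly (\<lambda>z \<zeta>. ?K z \<zeta> + (-1 / (2 * \<i>)) * (G z + (-1) * cnj (G \<zeta>)))"
  proof (intro line_poly_add line_poly_mult line_poly_const)
    show "line_poly (tens I (\<lambda>i. field_deriv F (a i)) b)"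
      by (rule line_poly_tens[where \<mu>=\<mu>]) (use fin H H_X in blast)+
    show "line_poly (tens I a (\<lambda>i. field_deriv F (b i)))"
      by (rule line_poly_tens[where \<mu>=\<mu>]) (use fin H H_X in blast)+
  qed (rule line_poly_left[OF G] line_poly_right[OF G])+
  ultimately have eq: "?K z \<zeta> + (-1 / (2 * \<i>)) * (G z + (-1) * cnj (G \<zeta>)) = 0" for z \<zeta>
    using polarization[of "\<lambda>z \<zeta>. ?K z \<zeta> + (-1 / (2 * \<i>)) * (G z + (-1) * cnj (G \<zeta>))"] by blast
  have F0: "F 0 = 0" by (rule whom_field_at_zero[OF Y(4) \<mu> F])
  have G0: "G 0 = 0" by (rule whom_z_at_zero[OF G]) (use Y(4) in simp)
  \<comment> \<open>The first half is X applied to the zero slice T(z, 0); the second contains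
    derivatives at 0 along F(0) = 0. The polarized equation at \<open>\<zeta>\<close> = 0 then
    leaves G z = cnj (G 0) = 0.\<close>
  have K0: "?K z 0 = 0" for z
  proof -
    have "tens I (\<lambda>i. field_deriv F (a i)) b z 0 = field_deriv F (\<lambda>z. tens I a b z 0) z"
      using X_tens_left[OF fin W(1)] by simp
    moreover have "\<dots> = 0" unfolding slice0 by (simp add: X_zero)
    moreover have "field_deriv F f 0 = 0" if "chol f" for f
      using linear_0[OF has_derivative_linear[OF chol_has_derivative[OF that]]]
      unfolding field_deriv_def F0 .
    then have "tens I a (\<lambda>i. field_deriv F (b i)) z 0 = 0"
      unfolding tens_def by (intro sum.neutral) (use W in auto)
    ultimately show ?thesis by simp
  qed
  have "G z = 0" for z using eq[of z 0] by (simp add: K0 G0)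
  then have "?K z \<zeta> = 0" for z \<zeta> using eq[of z \<zeta>] by simp
  then have "invariant_tensor (tens I a b)"
    by (intro iffD2[OF invariant_tens_iff[OF fin W]] allI)
  then show ?thesis unfolding F_def[abs_def] .
qed

section \<open>From chain tensors to symmetric pairs of chains\<close>

lemma apply_field_vec_chol:
  assumes "\<And>i. i < s \<Longrightarrow> chol (\<lambda>z. vec_index (U z) i)" "fst (Y (z, w)) = F z"
  shows "apply_field_vec Y s U (z, w) = vec s (\<lambda>i. field_deriv F (\<lambda>z. vec_index (U z) i) z)"
  unfolding apply_field_vec_def field_deriv_def
  by (rule eq_vecI) (simp_all add: apply_field_chol[OF assms(1)] assms(2))

lemma invertible_mat_unit:
  fixes c :: complex
  assumes "c * c = 1" shows "invertible_mat (c \<cdot>\<^sub>m 1\<^sub>m n)"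
proof -
  have "(c \<cdot>\<^sub>m 1\<^sub>m n) * (c \<cdot>\<^sub>m 1\<^sub>m n) = 1\<^sub>m n"
    by (rule eq_matI) (simp_all add: assms)
  then show ?thesis
    using assms unfolding invertible_mat_def inverts_mat_def
    by (intro conjI exI[of _ "c \<cdot>\<^sub>m 1\<^sub>m n"]) simp_all
qed

text \<open>The sign in the second chain gives X V_k = - V_(k+1), so B = -1 is matched by A = 1.
  Both chains stop at N since X^N kills u and v.\<close>

lemma symmetric_chain_pair_of_chain_data:
  assumes gop: "graded_operator (whom_z \<mu>) chol (field_deriv F) \<nu>"
    and Y: "\<And>z w. fst (Y (z, w)) = F z"
    and chain: "graded_operator.chain_data (whom_z \<mu>) (field_deriv F) (N, u, v)"
  shows "symmetric_chain_pair \<mu> Y 1 N (\<lambda>k z. vec 1 (\<lambda>_. (field_deriv F ^^ (k - 1)) u z))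
    (\<lambda>k z. vec 1 (\<lambda>_. (-1) ^ (k - 1) * (field_deriv F ^^ (k - 1)) v z))"
proof -
  interpret graded_operator "whom_z \<mu>" chol "field_deriv F" \<nu> by (rule gop)
  let ?X = "field_deriv F"
  let ?U = "\<lambda>k z. vec 1 (\<lambda>_. (?X ^^ (k - 1)) u z)"
  let ?V = "\<lambda>k z. vec 1 (\<lambda>_. (-1) ^ (k - 1) * (?X ^^ (k - 1)) v z)"
  obtain \<kappa> \<eta> where H: "whom_z \<mu> \<kappa> u" "whom_z \<mu> \<eta> v" and N: "0 < N"
    "(?X ^^ N) u = (\<lambda>_. 0)" "(?X ^^ N) v = (\<lambda>_. 0)"
    using chain unfolding chain_data_def by auto
  have W: "chol ((?X ^^ k) u)" "chol ((?X ^^ k) v)" for k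
    using H H_funpow H_W by blast+
  \<comment> \<open>\<open>0 < k\<close> rules out the truncated difference
    \<open>0 - 1 = 0\<close>, for which the exponent would not rise to k.\<close>
  have U: "apply_field_vec Y 1 (?U k) (z, w) = vec 1 (\<lambda>_. (?X ^^ k) u z)" if k: "0 < k" for k z w
  proof -
    obtain l where "k = Suc l" using k by (cases k) auto
    then show ?thesis by (subst apply_field_vec_chol[where Y=Y and F=F]) (auto simp: W Y intro!: eq_vecI)
  qed
  have V: "apply_field_vec Y 1 (?V k) (z, w) = vec 1 (\<lambda>_. (-1) ^ (k - 1) * (?X ^^ k) v z)"
    if k: "0 < k" for k z w
  proof -
    obtain l where "k = Suc l" using k by (cases k) auto
    then show ?thesis
      by (subst apply_field_vec_chol[where Y=Y and F=F])
        (auto simp: W Y chol_mult chol_const field_deriv_scale intro!: eq_vecI)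
  qed
  have hom: "whom_vec \<mu> 1 (?U k)" "whom_vec \<mu> 1 (?V k)" for k
    unfolding whom_vec_def using H_funpow[OF H(1), of "k - 1"] H_scale[OF H_funpow[OF H(2), of "k - 1"]]
    by auto
  have last: "apply_field_vec Y 1 (?U N) (z, w) = 0\<^sub>v 1" "apply_field_vec Y 1 (?V N) (z, w) = 0\<^sub>v 1" for z w
    unfolding U[OF N(1)] V[OF N(1)] by (auto simp: N intro!: eq_vecI)
  have step: "apply_field_vec Y 1 (?U k) (z, w) = 1\<^sub>m 1 *\<^sub>v ?U (k + 1) z"
    "apply_field_vec Y 1 (?V k) (z, w) = ((-1) \<cdot>\<^sub>m 1\<^sub>m 1) *\<^sub>v ?V (k + 1) z" if k: "0 < k" for k z w
  proof -
    obtain l where "k = Suc l" using k by (cases k) auto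
    then show "apply_field_vec Y 1 (?U k) (z, w) = 1\<^sub>m 1 *\<^sub>v ?U (k + 1) z"
      "apply_field_vec Y 1 (?V k) (z, w) = ((-1) \<cdot>\<^sub>m 1\<^sub>m 1) *\<^sub>v ?V (k + 1) z"
      unfolding U[OF k] V[OF k] by (auto simp: scalar_prod_def intro!: eq_vecI)
  qed
  define A :: "complex mat" where "A = 1\<^sub>m 1"
  define B :: "complex mat" where "B = (-1) \<cdot>\<^sub>m 1\<^sub>m 1"
  have mats: "A \<in> carrier_mat 1 1" "B \<in> carrier_mat 1 1" "A = - transpose_mat (map_mat cnj B)"
    unfolding A_def B_def by (auto intro!: eq_matI)
  have "A = 1 \<cdot>\<^sub>m 1\<^sub>m 1" unfolding A_def by (rule eq_matI) auto
  then have inv: "invertible_mat A" "invertible_mat B"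
    using invertible_mat_unit[of 1 1] invertible_mat_unit[of "-1" 1] unfolding B_def by simp_all
  have "\<forall>j\<in>{1..<N}. A \<in> carrier_mat 1 1 \<and> invertible_mat A \<and> B \<in> carrier_mat 1 1 \<and>
      invertible_mat B \<and> A = - transpose_mat (map_mat cnj B) \<and>
      (\<forall>z w. apply_field_vec Y 1 (?U j) (z, w) = A *\<^sub>v ?U (j + 1) z \<and>
             apply_field_vec Y 1 (?V j) (z, w) = B *\<^sub>v ?V (j + 1) z)"
  proof (intro ballI conjI allI mats inv)
    fix j z w assume "j \<in> {1..<N}"
    then have "0 < j" by simp
    from step[OF this, folded A_def B_def, of z w]
    show "apply_field_vec Y 1 (?U j) (z, w) = A *\<^sub>v ?U (j + 1) z"
      "apply_field_vec Y 1 (?V j) (z, w) = B *\<^sub>v ?V (j + 1) z" .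
  qed
  then have "\<exists>A B. \<forall>j\<in>{1..<N}. A j \<in> carrier_mat 1 1 \<and> invertible_mat (A j) \<and>
      B j \<in> carrier_mat 1 1 \<and> invertible_mat (B j) \<and>
      A j = - transpose_mat (map_mat cnj (B (N - j))) \<and>
      (\<forall>z w. apply_field_vec Y 1 (?U j) (z, w) = A j *\<^sub>v ?U (j + 1) z \<and>
             apply_field_vec Y 1 (?V j) (z, w) = B j *\<^sub>v ?V (j + 1) z)"
    by (intro exI[of _ "\<lambda>_. A"] exI[of _ "\<lambda>_. B"])
  then show ?thesis
    unfolding symmetric_chain_pair_def using hom last by blast
qed

lemma conjugate_scalar_prod:
  "dim_vec v = s \<Longrightarrow> u \<bullet>c v = (\<Sum>i<s. vec_index u i * cnj (vec_index v i))"
  by (auto simp: scalar_prod_def atLeast0LessThan intro!: sum.cong)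

text \<open>All chains obtained have dimension 1. Individual chain tensors may fail to be real on
  the diagonal, but their sum P is real, so termwise real parts leave it unchanged.\<close>

lemma chain_decomposition_exists:
  fixes P :: "complex^'n::{finite,linorder} \<Rightarrow> real"
  assumes lead: "has_leading_polynomial M p \<mu> P" and \<mu>: "\<And>j. 0 < \<mu> j" and Y: "Y \<in> g_c \<mu> P"
  shows "has_chain_decomposition \<mu> Y P"
proof -
  obtain \<nu> where \<nu>: "0 < \<nu>" "whom_field \<mu> \<nu> Y" and aut: "Y \<in> aut_fields P" "rigid_field Y"
    using Y unfolding g_c_def by blast
  define F where "F z = fst (Y (z, 0))" for z
  have F: "whom_z \<mu> (\<nu> + \<mu> j) (\<lambda>z. F z $ j)" for j
    unfolding F_def by (rule whom_field_slice[OF \<nu>(2)])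
  have gop: "graded_operator (whom_z \<mu>) chol (field_deriv F) \<nu>"
    by (rule graded_operator_field_deriv[OF \<nu>(1) F])
  interpret graded_operator "whom_z \<mu>" chol "field_deriv F" \<nu> by (rule gop)
  have YF: "fst (Y (z, w)) = F z" for z w
    using aut(2) unfolding rigid_field_def F_def by metis
  have P0: "P \<noteq> (\<lambda>_. 0)" and hom: "whom_zzbar \<mu> 1 (\<lambda>z. complex_of_real (P z))"
    and np: "no_pluriharmonic_terms (\<lambda>z. complex_of_real (P z))"
    using lead unfolding has_leading_polynomial_def by blast+
  obtain I a b where I: "finite I" "I \<subseteq> {(\<alpha>, \<beta>). wdeg \<mu> \<alpha> + wdeg \<mu> \<beta> = 1}"
    and P: "\<And>z. complex_of_real (P z) = tens I a b z z"
    and ab: "\<And>i. i \<in> I \<Longrightarrow> whom_z \<mu> (wdeg \<mu> (fst i)) (a i) \<and> b i = (\<lambda>z. zmonom z (snd i))"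
    using zzbar_poly_tens[OF hom[unfolded whom_zzbar_def], of \<mu>] by blast
  have "whom_z \<mu> (1 - wdeg \<mu> (fst i)) (b i)" if "i \<in> I" for i
  proof -
    have "wdeg \<mu> (fst i) + wdeg \<mu> (snd i) = 1" using I(2) that by auto
    then have "wdeg \<mu> (snd i) = 1 - wdeg \<mu> (fst i)" by (simp add: algebra_simps)
    from whom_z_monom[OF this] show ?thesis using ab[OF that] by simp
  qed
  then have gr: "graded_family 1 I (\<lambda>i. wdeg \<mu> (fst i)) a b"
    using I ab unfolding graded_family_def by blast
  have "invariant_tensor (tens I a b)"
    using aut_field_invariant_tensor[OF aut \<nu>(2,1) \<mu> gr P np] unfolding F_def[abs_def] .
  from chain_decomposition[OF gr this] obtain R where
    R: "\<And>c. c \<in> set R \<Longrightarrow> chain_data c"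
      "\<And>z \<zeta>. tens I a b z \<zeta> = (\<Sum>(N, u, v)\<leftarrow>R. chain_tensor N u v z \<zeta>)" by blast
  define N where "N j = fst (R ! (j - 1))" for j
  define u where "u j = fst (snd (R ! (j - 1)))" for j
  define v where "v j = snd (snd (R ! (j - 1)))" for j
  define U where "U j k z = vec 1 (\<lambda>_. (field_deriv F ^^ (k - 1)) (u j) z)" for j k z
  define V where "V j k z = vec 1 (\<lambda>_. (-1) ^ (k - 1) * (field_deriv F ^^ (k - 1)) (v j) z)" for j k z
  have data: "chain_data (N j, u j, v j)" if "j \<in> {1..length R}" for j
    using R(1)[of "R ! (j - 1)"] that unfolding N_def u_def v_def by auto
  \<comment> \<open>The leading polynomial is nonzero; this supplies the positive number of
    terms.\<close>
  have "R \<noteq> []"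
    using P0 P R(2) by (auto simp: fun_eq_iff)
  then have len: "0 < length R" by simp
  have "N j > 0 \<and> symmetric_chain_pair \<mu> Y 1 (N j) (U j) (V j)" if "j \<in> {1..length R}" for j
    using data[OF that] symmetric_chain_pair_of_chain_data[OF gop YF data[OF that]]
    unfolding U_def[abs_def] V_def[abs_def] chain_data_def by auto
  moreover have "P z = (\<Sum>j=1..length R. Re (\<Sum>k=1..N j. U j k z \<bullet>c V j (N j - k + 1) z))" for z
  proof -
    \<comment> \<open>U_k carries X^(k-1) and V_(N-k+1) carries (-X)^(N-k): together they are
      summand k-1 of the chain tensor.\<close>
    have chain_term: "(\<Sum>k=1..N j. U j k z \<bullet>c V j (N j - k + 1) z) = chain_tensor (N j) (u j) (v j) z z" for j
    proof -
      have "(\<Sum>k=1..N j. U j k z \<bullet>c V j (N j - k + 1) z)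
          = (\<Sum>k<N j. U j (Suc k) z \<bullet>c V j (N j - Suc k + 1) z)"
        by (rule sum.reindex_bij_witness[of _ Suc "\<lambda>k. k - 1"]) auto
      also have "\<dots> = chain_tensor (N j) (u j) (v j) z z"
        unfolding chain_tensor_def tens_def U_def V_def
        by (rule sum.cong) (simp_all add: scalar_prod_def)
      finally show ?thesis .
    qed
    have "P z = Re (tens I a b z z)" using P by (metis Re_complex_of_real)
    also have "\<dots> = (\<Sum>(N, u, v)\<leftarrow>R. Re (chain_tensor N u v z z))"
      unfolding R(2) by (induction R) (auto split: prod.split)
    also have "\<dots> = (\<Sum>i<length R. Re (chain_tensor (N (Suc i)) (u (Suc i)) (v (Suc i)) z z))"
      unfolding sum_list_sum_nth atLeast0LessThan
      by (rule sum.cong) (simp_all add: N_def u_def v_def case_prod_unfold)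
    also have "\<dots> = (\<Sum>j=1..length R. Re (chain_tensor (N j) (u j) (v j) z z))"
      by (rule sum.reindex_bij_witness[of _ "\<lambda>k. k - 1" Suc]) auto
    finally show ?thesis unfolding chain_term .
  qed
  ultimately show ?thesis
    unfolding has_chain_decomposition_def using len
    by (intro exI[of _ "length R"] exI[of _ N] exI[of _ "\<lambda>_. 1"] exI[of _ U] exI[of _ V]) auto
qed

section \<open>The converse\<close>

lemma conjugate_adjoint:
  assumes A: "A \<in> carrier_mat s s" "B \<in> carrier_mat s s" "A = - transpose_mat (map_mat cnj B)"
    and u: "u \<in> carrier_vec s" and v: "v \<in> carrier_vec s"
  shows "(A *\<^sub>v u) \<bullet>c v = - (u \<bullet>c (B *\<^sub>v v))"
proof -
  have "(A *\<^sub>v u) \<bullet>c v = (\<Sum>i<s. (\<Sum>j<s. - cnj (B $$ (j, i)) * vec_index u j) * cnj (vec_index v i))"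
    using A u v by (auto simp: conjugate_scalar_prod scalar_prod_def atLeast0LessThan sum_negf intro!: sum.cong)
  also have "\<dots> = (\<Sum>j<s. - (vec_index u j * cnj (\<Sum>i<s. B $$ (j, i) * vec_index v i)))"
    unfolding sum_distrib_right cnj_sum sum_distrib_left sum_negf[symmetric]
    by (subst sum.swap) (simp add: mult_ac)
  also have "\<dots> = - (u \<bullet>c (B *\<^sub>v v))"
    using A u v by (auto simp: conjugate_scalar_prod scalar_prod_def atLeast0LessThan sum_negf intro!: sum.cong)
  finally show ?thesis .
qed

text \<open>By A_k = - (adjoint of B_(N-k)), \<langle>X U_k, V_(N-k+1)\<rangle> = -
  \<langle>U_(k+1), X V_(N-k)\<rangle>, so the first half of summand k cancels the second half of
  summand k+1. The chain ends remove what is left over.\<close>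

lemma chain_pair_term_derivative:
  assumes chain: "symmetric_chain_pair \<mu> Y s N U V" and N: "0 < N"
    and Y: "\<And>z w. fst (Y (z, w)) = F z"
  shows "\<exists>D. ((\<lambda>z. Re (\<Sum>k=1..N. U k z \<bullet>c V (N - k + 1) z)) has_derivative D) (at z) \<and> D (F z) = 0"
proof -
  have hom: "whom_vec \<mu> s (U k)" "whom_vec \<mu> s (V k)" if "k \<in> {1..N}" for k
    using chain that unfolding symmetric_chain_pair_def by blast+
  have dim: "U k z \<in> carrier_vec s" "V k z \<in> carrier_vec s" if "k \<in> {1..N}" for k z
    using hom[OF that] unfolding whom_vec_def by blast+
  have W: "chol (\<lambda>z. vec_index (U k z) i)" "chol (\<lambda>z. vec_index (V k z) i)" if "k \<in> {1..N}" "i < s" for k i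
    using hom[OF that(1)] that(2) chol_whom_z unfolding whom_vec_def by blast+
  define XU where "XU k z = vec s (\<lambda>i. field_deriv F (\<lambda>z. vec_index (U k z) i) z)" for k z
  define XV where "XV k z = vec s (\<lambda>i. field_deriv F (\<lambda>z. vec_index (V k z) i) z)" for k z
  have apply_eq: "apply_field_vec Y s (U k) (z, w) = XU k z" "apply_field_vec Y s (V k) (z, w) = XV k z"
    if "k \<in> {1..N}" for k z w
    unfolding XU_def XV_def using W[OF that] Y by (auto intro!: apply_field_vec_chol[where Y=Y and F=F])
  obtain A B where AB: "\<And>j. j \<in> {1..<N} \<Longrightarrow> A j \<in> carrier_mat s s \<and> B j \<in> carrier_mat s s \<and>
      A j = - transpose_mat (map_mat cnj (B (N - j))) \<and>
      (\<forall>z. XU j z = A j *\<^sub>v U (j + 1) z \<and> XV j z = B j *\<^sub>v V (j + 1) z)"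
  proof -
    obtain A B where AB: "\<forall>j\<in>{1..<N}. A j \<in> carrier_mat s s \<and> invertible_mat (A j) \<and>
        B j \<in> carrier_mat s s \<and> invertible_mat (B j) \<and>
        A j = - transpose_mat (map_mat cnj (B (N - j))) \<and>
        (\<forall>z w. apply_field_vec Y s (U j) (z, w) = A j *\<^sub>v U (j + 1) z \<and>
               apply_field_vec Y s (V j) (z, w) = B j *\<^sub>v V (j + 1) z)"
      using chain unfolding symmetric_chain_pair_def by blast
    have "XU j z = A j *\<^sub>v U (j + 1) z \<and> XV j z = B j *\<^sub>v V (j + 1) z"
      if "j \<in> {1..<N}" for j z
    proof -
      have "j \<in> {1..N}" using that by simp
      from apply_eq[OF this] show ?thesis using AB that by metis
    qed
    with AB show ?thesis by (intro that[of A B]) blast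
  qed
  have last: "XU N z = 0\<^sub>v s" "XV N z = 0\<^sub>v s"
    using chain apply_eq[of N] N unfolding symmetric_chain_pair_def by auto
  have expand: "U k z \<bullet>c V (N - k + 1) z = tens {..<s} (\<lambda>i z. vec_index (U k z) i) (\<lambda>i z. vec_index (V (N - k + 1) z) i) z z"
    if "k \<in> {1..N}" for k z
  proof -
    have "N - k + 1 \<in> {1..N}" using that by auto
    from dim(2)[OF this, of z] show ?thesis
      by (subst conjugate_scalar_prod[where s=s]) (simp_all add: tens_def)
  qed
  have "\<exists>D. ((\<lambda>z. U k z \<bullet>c V (N - k + 1) z) has_derivative D) (at z) \<and>
      D (F z) = XU k z \<bullet>c V (N - k + 1) z + U k z \<bullet>c XV (N - k + 1) z" if k: "k \<in> {1..N}" for k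
  proof -
    have k': "N - k + 1 \<in> {1..N}" using k by auto
    have "XU k z \<bullet>c V (N - k + 1) z = tens {..<s} (\<lambda>i. field_deriv F (\<lambda>z. vec_index (U k z) i)) (\<lambda>i z. vec_index (V (N - k + 1) z) i) z z"
      using dim(2)[OF k', of z] by (simp add: conjugate_scalar_prod tens_def XU_def)
    moreover have "U k z \<bullet>c XV (N - k + 1) z = tens {..<s} (\<lambda>i z. vec_index (U k z) i) (\<lambda>i. field_deriv F (\<lambda>z. vec_index (V (N - k + 1) z) i)) z z"
      by (subst conjugate_scalar_prod[where s=s]) (simp_all add: tens_def XV_def)
    ultimately show ?thesis
      unfolding expand[OF k] using has_derivative_tens_diag[of "{..<s}" "\<lambda>i z. vec_index (U k z) i"
          "\<lambda>i z. vec_index (V (N - k + 1) z) i" z F] W[OF k] W[OF k'] by simp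
  qed
  then have "\<forall>k\<in>{1..N}. \<exists>D. ((\<lambda>z. U k z \<bullet>c V (N - k + 1) z) has_derivative D) (at z) \<and>
      D (F z) = XU k z \<bullet>c V (N - k + 1) z + U k z \<bullet>c XV (N - k + 1) z"
    by blast
  from bchoice[OF this] obtain D where D: "\<And>k. k \<in> {1..N} \<Longrightarrow> ((\<lambda>z. U k z \<bullet>c V (N - k + 1) z) has_derivative D k) (at z)"
    "\<And>k. k \<in> {1..N} \<Longrightarrow> D k (F z) = XU k z \<bullet>c V (N - k + 1) z + U k z \<bullet>c XV (N - k + 1) z"
    by blast
  \<comment> \<open>The guard makes the boundary values \<open>e 0\<close> and \<open>e N\<close>
    vanish, where the chain relations with \<open>A\<close> and \<open>B\<close> say
    nothing.\<close>
  define e where "e k = (if k \<in> {1..<N} then XU k z \<bullet>c V (N - k + 1) z else 0)" for k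
  have "D k (F z) = e k - e (k - 1)" if k: "k \<in> {1..N}" for k
  proof -
    have "XU k z \<bullet>c V (N - k + 1) z = e k"
    proof (cases "k = N")
      case True
      then show ?thesis using last(1) dim(2)[of 1 z] N unfolding e_def
        by (simp add: conjugate_scalar_prod)
    next
      case False
      then show ?thesis using k unfolding e_def by simp
    qed
    moreover have "U k z \<bullet>c XV (N - k + 1) z = - e (k - 1)"
    proof (cases "k = 1")
      case True
      then show ?thesis using last(2) N unfolding e_def by (simp add: scalar_prod_def)
    next
      case False
      \<comment> \<open>The symmetry condition pairs A_(k-1) with B_(N-(k-1)), and N-(k-1) = N-k+1
        is exactly the index of V in summand k.\<close>
      then have k1: "k - 1 \<in> {1..<N}" "N - (k - 1) \<in> {1..<N}" "N - (k - 1) + 1 \<in> {1..N}"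
        "N - k + 1 = N - (k - 1)" "k - 1 + 1 = k" using k by auto
      have "e (k - 1) = (A (k - 1) *\<^sub>v U k z) \<bullet>c V (N - (k - 1) + 1) z"
        using AB[OF k1(1)] k1(1,5) unfolding e_def by simp
      also have "\<dots> = - (U k z \<bullet>c (B (N - (k - 1)) *\<^sub>v V (N - (k - 1) + 1) z))"
        by (rule conjugate_adjoint) (use AB[OF k1(1)] AB[OF k1(2)] dim(1)[OF k] dim(2)[OF k1(3)] in auto)
      also have "\<dots> = - (U k z \<bullet>c XV (N - k + 1) z)"
        using AB[OF k1(2)] k1(4) by simp
      finally show ?thesis by simp
    qed
    ultimately show ?thesis using D(2)[OF k] by simp
  qed
  then have "(\<Sum>k=1..N. D k (F z)) = (\<Sum>k=Suc 0..N. e k - e (k - 1))" by simp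
  also have "\<dots> = e N - e 0" by (rule sum_telescope'') simp
  finally have D0: "(\<Sum>k=1..N. D k (F z)) = 0" by (simp add: e_def)
  have "((\<lambda>z. Re (\<Sum>k=1..N. U k z \<bullet>c V (N - k + 1) z)) has_derivative
      (\<lambda>v. Re (\<Sum>k=1..N. D k v))) (at z)"
    by (intro has_derivative_Re has_derivative_sum D(1))
  then show ?thesis
    by (intro exI[of _ "\<lambda>v. Re (\<Sum>k=1..N. D k v)"] conjI) (simp_all only: D0 zero_complex.simps)
qed

lemma hol_on_chol:
  assumes "chol f" shows "hol_on S (\<lambda>x. f (fst x))"
  unfolding hol_on_def
proof
  fix x :: "(complex^'a) \<times> complex"
  show "\<exists>D. ((\<lambda>x. f (fst x)) has_derivative D) (at x) \<and> (\<forall>c v. D (cscale c v) = c * D v)"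
    using has_derivative_fst_chol[OF assms, of x] chol_scale_derivative[OF assms]
    by (intro exI[of _ "\<lambda>h. frechet_derivative f (at (fst x)) (fst h)"]) (simp add: cscale_def)
qed

text \<open>P is constant along F and the coefficient of d/dw is 0, so Re Y annihilates the defining
  function on all of C^(n+1), not only on the model.\<close>

lemma g_c_of_chain_decomposition:
  fixes P :: "complex^'n::{finite,linorder} \<Rightarrow> real" and F :: "complex^'n::{finite,linorder} \<Rightarrow> complex^'n::{finite,linorder}"
  assumes \<nu>: "0 < \<nu>" and field: "whom_field \<mu> \<nu> (\<lambda>(z, w). (F z, 0))"
    and dec: "has_chain_decomposition \<mu> (\<lambda>(z, w). (F z, 0)) P"
  shows "(\<lambda>(z, w). (F z, 0)) \<in> g_c \<mu> P"
proof -
  let ?Y = "\<lambda>(z, w). (F z, 0) :: (complex^'n::{finite,linorder}) \<times> complex"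
  have F: "chol (\<lambda>z. F z $ j)" for j
    using whom_field_slice(1)[OF field, of j] chol_whom_z by simp
  obtain M N s U V where
    chain: "\<And>j. j \<in> {1..M::nat} \<Longrightarrow> 0 < N j \<and> symmetric_chain_pair \<mu> ?Y (s j) (N j) (U j) (V j)"
    and P: "\<And>z. P z = (\<Sum>j=1..M. Re (\<Sum>k=1..N j. U j k z \<bullet>c V j (N j - k + 1) z))"
    using dec unfolding has_chain_decomposition_def by blast
  have "\<exists>D. (P has_derivative D) (at z) \<and> D (F z) = 0" for z
  proof -
    have "\<exists>D. ((\<lambda>z. Re (\<Sum>k=1..N j. U j k z \<bullet>c V j (N j - k + 1) z)) has_derivative D) (at z) \<and> D (F z) = 0"
      if "j \<in> {1..M}" for j
      by (rule chain_pair_term_derivative[where Y="?Y"]) (use chain[OF that] in auto)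
    then have "\<forall>j\<in>{1..M}. \<exists>D. ((\<lambda>z. Re (\<Sum>k=1..N j. U j k z \<bullet>c V j (N j - k + 1) z)) has_derivative D) (at z) \<and> D (F z) = 0"
      by blast
    from bchoice[OF this] obtain D where D: "\<And>j. j \<in> {1..M} \<Longrightarrow>
        ((\<lambda>z. Re (\<Sum>k=1..N j. U j k z \<bullet>c V j (N j - k + 1) z)) has_derivative D j) (at z)"
      "\<And>j. j \<in> {1..M} \<Longrightarrow> D j (F z) = 0"
      by blast
    have "(P has_derivative (\<lambda>v. \<Sum>j=1..M. D j v)) (at z)"
      unfolding P[abs_def] by (intro has_derivative_sum D(1))
    moreover have "(\<Sum>j=1..M. D j (F z)) = 0" by (rule sum.neutral) (use D(2) in blast)
    ultimately show ?thesis by (intro exI[of _ "\<lambda>v. \<Sum>j=1..M. D j v"] conjI)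
  qed
  then have "Re (apply_field ?Y (model_defining P) x) = 0" for x
    using Re_apply_field_model[of P _ "fst x" ?Y "snd x"] by fastforce
  moreover have "hol_map_on UNIV ?Y"
    using hol_on_chol[OF F] hol_on_chol[OF chol_const, of UNIV 0]
    unfolding hol_map_on_def by (simp add: case_prod_unfold)
  ultimately have "?Y \<in> aut_fields P"
    unfolding aut_fields_def by (intro CollectI exI[of _ UNIV]) auto
  then show ?thesis
    using \<nu> field unfolding g_c_def rigid_field_def by auto
qed

theorem theorem1p4:
  fixes \<mu> :: "'n::{finite,linorder} \<Rightarrow> rat" and P :: "complex^'n::{finite,linorder} \<Rightarrow> real"
  assumes "is_model \<mu> P"
  shows "(hol_nondegenerate P \<longrightarrow>
            (\<forall>Y \<in> g_c \<mu> P. nonzero_germ Y \<longrightarrow> has_chain_decomposition \<mu> Y P)) \<and>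
         (\<forall>(F :: complex^'n::{finite,linorder} \<Rightarrow> complex^'n::{finite,linorder}) \<nu>.
            0 < \<nu> \<and> whom_field \<mu> \<nu> (\<lambda>(z, w). (F z, 0)) \<and>
            has_chain_decomposition \<mu> (\<lambda>(z, w). (F z, 0)) P
            \<longrightarrow> (\<lambda>(z, w). (F z, 0)) \<in> g_c \<mu> P)"
proof -
  obtain M p where lead: "has_leading_polynomial M p \<mu> P" and w: "multitype_weight M p \<mu>"
    and ne: "\<And>j. \<mu> j \<noteq> 0"
    using assms unfolding is_model_def by blast
  have "0 < \<mu> j" for j
    using w ne[of j] unfolding multitype_weight_def is_weight_def by (simp add: less_le)
  then show ?thesis
    using chain_decomposition_exists[OF lead] g_c_of_chain_decomposition by blast
qed

end
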